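(* $(\mathfrak U,\rho_{\mathfrak U})$ and $(\mathfrak S,\rho_{\mathfrak S})$ are two complete separable metric spaces, i.e., Polish spaces.
   Context: Fix $d\in\mathbb N$. $\Omega_0=\{\omega\in C([0,\infty);\mathbb R^d):\omega(0)=0\}$ with the topology of locally uniform convergence, $P_0$ is the Wiener measure on $(\Omega_0,\mathscr B(\Omega_0))$, $W$ the canonical process on $\Omega_0$. $\mathcal F^W_s$ is the sigma-field generated by $W_r$, $r\in[0,s]$, $\mathcal F^W_\infty$ the one generated by $\bigcup_s\mathcal F^W_s$; $\mathcal F^{W,P_0}_s$ is the sigma-field generated by $\mathcal F^W_s$ and all subsets of $P_0$-null sets of $\mathcal F^W_\infty$, and $\mathbf F^{W,P_0}=\{\mathcal F^{W,P_0}_s\}_{s\ge0}$. $\mathbb U$ is a Polish space with a compatible metric $\rho_{\mathbb U}$ under which it is complete. $\mathfrak U$ is the set of equivalence classes of all $\mathbb U$-valued $\mathbf F^{W,P_0}$-predictable processes $\mu=\{\mu_s\}_{s\ge0}$ on $\Omega_0$, where $\mu^1,\mu^2$ are equivalent if $\{(s,\omega_0)\in[0,\infty)\times\Omega_0:\mu^1_s(\omega_0)\ne\mu^2_s(\omega_0)\}$ is a $ds\times dP_0$-null set, with the metric $\rho_{\mathfrak U}(\mu^1,\mu^2)=E_{P_0}\big[\int_0^\infty e^{-s}\big(1\wedge\rho_{\mathbb U}(\mu^1_s,\mu^2_s)\big)ds\big]$. $\mathfrak S$ is the set of equivalence classes of all $[0,\infty]$-valued $\mathbf F^{W,P_0}$-stopping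 times on $\Omega_0$, where $\tau_1,\tau_2$ are equivalent if $P_0\{\tau_1=\tau_2\}=1$, with the metric $\rho_{\mathfrak S}(\tau_1,\tau_2)=E_{P_0}[\rho_+(\tau_1,\tau_2)]$, where $\rho_+(t_1,t_2)=|\arctan t_1-\arctan t_2|$ on $[0,\infty]$. *)

theory Defs
  imports "HOL-Probability.Probability"
begin

section \<open>Path space and Wiener measure\<close>

text \<open>Elements of \<open>C([0,\<infinity>); R\<^sup>d)\<close> are represented by functions on the reals that are
  \<open>undefined\<close> at negative times, so that two paths are equal iff they agree on \<open>[0,\<infinity>)\<close>.\<close>

definition path_space :: "(real \<Rightarrow> real^'d) set" where
  "path_space = {\<omega> \<in> extensional {0..}. continuous_on {0..} \<omega> \<and> \<omega> 0 = 0}"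

text \<open>Locally uniform convergence: the subbasic sets are the open balls of the seminorms
  \<open>sup {norm (\<omega> t) | t \<in> [0,T]}\<close>; by continuity on \<open>[0,T]\<close> the strict bound on the supremum is
  the pointwise strict bound.\<close>

definition path_topology :: "(real \<Rightarrow> real^'d) topology" where
  "path_topology = topology_generated_by
     {{\<omega>' \<in> path_space. \<forall>t\<in>{0..T}. dist (\<omega> t) (\<omega>' t) < e} | \<omega> T e.
        \<omega> \<in> path_space \<and> 0 \<le> T \<and> 0 < e}"

definition path_borel :: "(real \<Rightarrow> real^'d) measure" where
  "path_borel = sigma path_space {U. openin path_topology U}"

text \<open>The Wiener measure is the unique law on path space under which the canonical process
  \<open>W t \<omega> = \<omega> t\<close> is a standard \<open>d\<close>-dimensional Brownian motion: along every partition, the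
  coordinates of all the increments are jointly independent, and each of them is centred Gaussian
  with variance the length of the time step. (\<open>normal_density\<close> takes the standard deviation.)\<close>

definition wiener_measure :: "(real \<Rightarrow> real^'d) measure \<Rightarrow> bool" where
  "wiener_measure P \<longleftrightarrow>
     prob_space P \<and> space P = path_space \<and> sets P = sets path_borel \<and>
     (\<forall>s t i. 0 \<le> s \<and> s < t \<longrightarrow>
        distributed P lborel (\<lambda>\<omega>. (\<omega> t - \<omega> s) $ i) (\<lambda>x. ennreal (normal_density 0 (sqrt (t - s)) x))) \<and>
     (\<forall>(n::nat) t. 0 \<le> t 0 \<and> strict_mono_on {..n} t \<longrightarrow>
        prob_space.indep_vars P (\<lambda>_. borel)
          (\<lambda>(k, i) \<omega>. (\<omega> (t (Suc k)) - \<omega> (t k)) $ i) ({..<n} \<times> UNIV))"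


section \<open>The augmented filtration of the canonical process\<close>

definition canonical_filtration :: "real \<Rightarrow> (real \<Rightarrow> real^'d) measure" where
  "canonical_filtration s =
     sigma path_space {(\<lambda>\<omega>. \<omega> r) -` B \<inter> path_space | r B. r \<in> {0..s} \<and> B \<in> sets borel}"

definition canonical_sigma_inf :: "(real \<Rightarrow> real^'d) measure" where
  "canonical_sigma_inf = sigma path_space (\<Union>s\<in>{0..}. sets (canonical_filtration s))"

definition augmented_filtration ::
    "(real \<Rightarrow> real^'d) measure \<Rightarrow> real \<Rightarrow> (real \<Rightarrow> real^'d) measure" where
  "augmented_filtration P s =
     sigma path_space (sets (canonical_filtration s) \<union>
       {N. \<exists>Z \<in> sets canonical_sigma_inf. emeasure P Z = 0 \<and> N \<subseteq> Z})"


section \<open>Quotient distance\<close>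

text \<open>The common value of \<open>d\<close> on all pairs of representatives. The value outside \<open>Q\<close> is irrelevant;
  it is set to \<open>0\<close> because the locale \<open>Metric_space\<close> asks for nonnegativity and symmetry on the
  whole type.\<close>

definition quotient_dist :: "'a set set \<Rightarrow> ('a \<Rightarrow> 'a \<Rightarrow> real) \<Rightarrow> 'a set \<Rightarrow> 'a set \<Rightarrow> real" where
  "quotient_dist Q d A B =
     (if A \<in> Q \<and> B \<in> Q then the_elem {d a b | a b. a \<in> A \<and> b \<in> B} else 0)"


section \<open>Predictable processes\<close>

text \<open>The predictable sigma-algebra on \<open>[0,\<infinity>) \<times> \<Omega>\<^sub>0\<close>, generated by the predictable rectangles.\<close>

definition predictable_sigma ::
    "(real \<Rightarrow> real^'d) measure \<Rightarrow> (real \<times> (real \<Rightarrow> real^'d)) measure" where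
  "predictable_sigma P =
     sigma ({0..} \<times> path_space)
       ({{0} \<times> A | A. A \<in> sets (augmented_filtration P 0)} \<union>
        {{s<..t} \<times> A | s t A. 0 \<le> s \<and> s < t \<and> A \<in> sets (augmented_filtration P s)})"

text \<open>Processes are total functions in HOL; their values off \<open>[0,\<infinity>) \<times> \<Omega>\<^sub>0\<close> are unconstrained and
  are identified by the equivalence relation below.\<close>

definition predictable_processes ::
    "(real \<Rightarrow> real^'d) measure \<Rightarrow> (real \<Rightarrow> (real \<Rightarrow> real^'d) \<Rightarrow> 'u::polish_space) set" where
  "predictable_processes P = {\<mu>. (\<lambda>(s, \<omega>). \<mu> s \<omega>) \<in> predictable_sigma P \<rightarrow>\<^sub>M borel}"

text \<open>Sets of the augmented filtration need not be Borel, so \<open>P\<close> has to be completed, both for the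
  \<open>ds \<times> dP\<close>-null sets here and for the expectations below (the Bochner integral of a non-measurable
  function is \<open>0\<close> by convention).\<close>

definition process_equiv ::
    "(real \<Rightarrow> real^'d) measure \<Rightarrow>
       ((real \<Rightarrow> (real \<Rightarrow> real^'d) \<Rightarrow> 'u::polish_space) \<times> (real \<Rightarrow> (real \<Rightarrow> real^'d) \<Rightarrow> 'u)) set" where
  "process_equiv P =
     {(\<mu>1, \<mu>2). \<mu>1 \<in> predictable_processes P \<and> \<mu>2 \<in> predictable_processes P \<and>
        {(s, \<omega>) \<in> {0..} \<times> path_space. \<mu>1 s \<omega> \<noteq> \<mu>2 s \<omega>} \<in> null_sets (lborel \<Otimes>\<^sub>M completion P)}"

definition control_space ::
    "(real \<Rightarrow> real^'d) measure \<Rightarrow> (real \<Rightarrow> (real \<Rightarrow> real^'d) \<Rightarrow> 'u::polish_space) set set" where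
  "control_space P = predictable_processes P // process_equiv P"

definition process_dist ::
    "(real \<Rightarrow> real^'d) measure \<Rightarrow> (real \<Rightarrow> (real \<Rightarrow> real^'d) \<Rightarrow> 'u::polish_space) \<Rightarrow>
       (real \<Rightarrow> (real \<Rightarrow> real^'d) \<Rightarrow> 'u) \<Rightarrow> real" where
  "process_dist P \<mu>1 \<mu>2 =
     (LINT \<omega>|completion P. (LBINT s:{0..}. exp (- s) * min 1 (dist (\<mu>1 s \<omega>) (\<mu>2 s \<omega>))))"

definition control_dist ::
    "(real \<Rightarrow> real^'d) measure \<Rightarrow> (real \<Rightarrow> (real \<Rightarrow> real^'d) \<Rightarrow> 'u::polish_space) set \<Rightarrow>
       (real \<Rightarrow> (real \<Rightarrow> real^'d) \<Rightarrow> 'u) set \<Rightarrow> real" where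
  "control_dist P = quotient_dist (control_space P) (process_dist P)"


section \<open>Stopping times\<close>

text \<open>The constant \<open>stopping_time\<close> of HOL-Probability has the values of the stopping time in the
  index set of the filtration, which would exclude the value \<open>\<infinity>\<close> here.\<close>

definition ext_stopping_times ::
    "(real \<Rightarrow> real^'d) measure \<Rightarrow> ((real \<Rightarrow> real^'d) \<Rightarrow> ennreal) set" where
  "ext_stopping_times P =
     {\<tau>. \<forall>t\<ge>0. Measurable.pred (augmented_filtration P t) (\<lambda>\<omega>. \<tau> \<omega> \<le> ennreal t)}"

definition stopping_equiv ::
    "(real \<Rightarrow> real^'d) measure \<Rightarrow>
       (((real \<Rightarrow> real^'d) \<Rightarrow> ennreal) \<times> ((real \<Rightarrow> real^'d) \<Rightarrow> ennreal)) set" where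
  "stopping_equiv P =
     {(\<tau>1, \<tau>2). \<tau>1 \<in> ext_stopping_times P \<and> \<tau>2 \<in> ext_stopping_times P \<and>
        measure (completion P) {\<omega> \<in> path_space. \<tau>1 \<omega> = \<tau>2 \<omega>} = 1}"

definition stopping_space ::
    "(real \<Rightarrow> real^'d) measure \<Rightarrow> ((real \<Rightarrow> real^'d) \<Rightarrow> ennreal) set set" where
  "stopping_space P = ext_stopping_times P // stopping_equiv P"

definition ext_arctan :: "ennreal \<Rightarrow> real" where
  "ext_arctan t = (if t = \<infinity> then pi / 2 else arctan (enn2real t))"

definition time_dist ::
    "(real \<Rightarrow> real^'d) measure \<Rightarrow> ((real \<Rightarrow> real^'d) \<Rightarrow> ennreal) \<Rightarrow>
       ((real \<Rightarrow> real^'d) \<Rightarrow> ennreal) \<Rightarrow> real" where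
  "time_dist P \<tau>1 \<tau>2 = (LINT \<omega>|completion P. \<bar>ext_arctan (\<tau>1 \<omega>) - ext_arctan (\<tau>2 \<omega>)\<bar>)"

definition stopping_dist ::
    "(real \<Rightarrow> real^'d) measure \<Rightarrow> ((real \<Rightarrow> real^'d) \<Rightarrow> ennreal) set \<Rightarrow>
       ((real \<Rightarrow> real^'d) \<Rightarrow> ennreal) set \<Rightarrow> real" where
  "stopping_dist P = quotient_dist (stopping_space P) (time_dist P)"


section \<open>Complete separable metric spaces\<close>

definition complete_separable_metric :: "'a set \<Rightarrow> ('a \<Rightarrow> 'a \<Rightarrow> real) \<Rightarrow> bool" where
  "complete_separable_metric M d \<longleftrightarrow>
     Metric_space M d \<and> Metric_space.mcomplete M d \<and> separable_space (Metric_space.mtopology M d)"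

end

theory Submission
  imports Defs
begin

text \<open>Both spaces are quotients of a space of random variables with values in a Polish space by
  almost everywhere equality, with a metric for convergence in measure. A Cauchy sequence has an
  almost everywhere convergent subsequence. For controls its pointwise limit is again predictable;
  for stopping times the upper limit is a stopping time of the right-continuous filtration, so
  completeness rests on the right-continuity of the augmented Brownian filtration, which follows from
  the independence of increments and the continuity of the paths alone.

  Separability holds because every measurable set in question is approximated in measure by the
  members of a countable algebra: up to null sets, the filtration is generated by the values of the
  canonical process at rational times.\<close>

section \<open>Quotients of pseudometric spaces\<close>

text \<open>A limit of stopping times is in general only an optional time: whether it is at most t
  may be decided just after t. Indeed \<open>\<tau> + 1/n\<close> is a stopping time whenever
  \<open>\<tau>\<close> is optional, and it tends to \<open>\<tau>\<close>. This is why completeness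
  needs right-continuity and not merely a good version of the limit.

  Separability is phrased through countable covers by sets of small diameter. An explicit dense set,
  such as the simple functions over a countable algebra, would leave the space, because its members
  ignore adaptedness. A cover avoids this: one member of the space is picked from each piece that
  meets it. For the same reason the approximating algebra need not respect time. The augmentation
  adds all subsets of null sets, for which countably many generators cannot be expected;
  approximation in measure does not see them.

  Replacing ds x dP by the finite measure with density e^{-s} makes both metrics instances of a
  single truncated distance.\<close>

lemma complete_separable_quotient:
  fixes d :: "'a \<Rightarrow> 'a \<Rightarrow> real"
  assumes nonneg: "\<And>x y. x \<in> S \<Longrightarrow> y \<in> S \<Longrightarrow> 0 \<le> d x y"
    and commute: "\<And>x y. x \<in> S \<Longrightarrow> y \<in> S \<Longrightarrow> d x y = d y x"
    and triangle: "\<And>x y z. x \<in> S \<Longrightarrow> y \<in> S \<Longrightarrow> z \<in> S \<Longrightarrow> d x z \<le> d x y + d y z"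
    and zero: "\<And>x. x \<in> S \<Longrightarrow> d x x = 0"
    and r: "r = {(x, y). x \<in> S \<and> y \<in> S \<and> d x y = 0}"
    and complete: "\<And>\<sigma>. (\<And>n::nat. \<sigma> n \<in> S) \<Longrightarrow>
        (\<And>e. 0 < e \<Longrightarrow> \<exists>N. \<forall>m\<ge>N. \<forall>n\<ge>N. d (\<sigma> m) (\<sigma> n) < e) \<Longrightarrow>
        \<exists>x\<in>S. \<exists>k::nat\<Rightarrow>nat. strict_mono k \<and> (\<lambda>n. d (\<sigma> (k n)) x) \<longlonglongrightarrow> 0"
    and separable: "\<And>e. 0 < e \<Longrightarrow> \<exists>\<C>. countable \<C> \<and> S \<subseteq> \<Union>\<C> \<and>
        (\<forall>B\<in>\<C>. \<forall>x\<in>B \<inter> S. \<forall>y\<in>B \<inter> S. d x y < e)"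
  shows "complete_separable_metric (S // r) (quotient_dist (S // r) d)"
proof -
  let ?Q = "S // r"
  let ?D = "quotient_dist ?Q d"
  have eq: "equiv S r"
    unfolding equiv_def refl_on_def sym_def trans_def r
    using commute zero by (auto) (metis add_0 nonneg order_antisym triangle)+
  \<comment> \<open>Moving an argument within its class costs nothing, by the triangle inequality in
    both directions. Hence the set under \<open>the_elem\<close> in \<open>quotient_dist\<close> is
    a singleton.\<close>
  have cong: "d x' y' = d x y" if "(x, x') \<in> r" "(y, y') \<in> r" for x x' y y'
  proof -
    have S: "x \<in> S" "x' \<in> S" "y \<in> S" "y' \<in> S" and z: "d x x' = 0" "d y y' = 0"
      using that by (auto simp: r)
    have "d x' y' \<le> d x' x + d x y + d y y'" "d x y \<le> d x x' + d x' y' + d y' y"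
      using triangle[of x' x y'] triangle[of x y y'] triangle[of x x' y] triangle[of x' y' y] S by auto
    then show ?thesis using z commute S by auto
  qed
  have D: "?D (r `` {x}) (r `` {y}) = d x y" if "x \<in> S" "y \<in> S" for x y
  proof -
    have "{d a b | a b. a \<in> r `` {x} \<and> b \<in> r `` {y}} = {d x y}"
      using cong that equiv_class_self[OF eq] by blast
    then show ?thesis using that by (simp add: quotient_dist_def quotientI)
  qed
  have rep: "\<exists>x\<in>S. A = r `` {x}" if "A \<in> ?Q" for A
    using that by (auto elim: quotientE)
  have D0: "?D A B = 0" if "\<not> (A \<in> ?Q \<and> B \<in> ?Q)" for A B
    using that by (simp add: quotient_dist_def del: de_Morgan_conj)
  interpret Metric_space ?Q ?D
  proof
    show "0 \<le> ?D A B" for A B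
      using rep D nonneg D0 by (metis order_refl)
    show "?D A B = ?D B A" for A B
      using rep[of A] rep[of B] D commute D0[of A B] D0[of B A] by metis
    show "?D A B = 0 \<longleftrightarrow> A = B" if "A \<in> ?Q" "B \<in> ?Q" for A B
    proof -
      obtain x y where "x \<in> S" "y \<in> S" "A = r `` {x}" "B = r `` {y}"
        using rep[OF \<open>A \<in> ?Q\<close>] rep[OF \<open>B \<in> ?Q\<close>] by blast
      then show ?thesis using D eq_equiv_class_iff[OF eq, of x y] by (auto simp: r)
    qed
    show "?D A C \<le> ?D A B + ?D B C" if "A \<in> ?Q" "B \<in> ?Q" "C \<in> ?Q" for A B C
    proof -
      obtain x y z where "x \<in> S" "y \<in> S" "z \<in> S" "A = r `` {x}" "B = r `` {y}" "C = r `` {z}"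
        using rep[OF \<open>A \<in> ?Q\<close>] rep[OF \<open>B \<in> ?Q\<close>] rep[OF \<open>C \<in> ?Q\<close>] by blast
      then show ?thesis using D triangle by simp
    qed
  qed
  have comp: mcomplete
    unfolding mcomplete_def
  proof safe
    fix \<sigma> assume "MCauchy \<sigma>"
    then have ran: "range \<sigma> \<subseteq> ?Q" and cau: "\<And>e. 0 < e \<Longrightarrow> \<exists>N. \<forall>m n. N \<le> m \<longrightarrow> N \<le> n \<longrightarrow> ?D (\<sigma> m) (\<sigma> n) < e"
      by (auto simp: MCauchy_def)
    obtain s where s: "\<And>n. s n \<in> S" "\<And>n. \<sigma> n = r `` {s n}"
      proof -
    have "\<forall>n. \<exists>x. x \<in> S \<and> \<sigma> n = r `` {x}" using ran rep by blast
    then show ?thesis using that by metis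
  qed
    have "\<exists>x\<in>S. \<exists>k::nat\<Rightarrow>nat. strict_mono k \<and> (\<lambda>n. d (s (k n)) x) \<longlonglongrightarrow> 0"
    proof (rule complete)
      show "\<exists>N. \<forall>m\<ge>N. \<forall>n\<ge>N. d (s m) (s n) < e" if "0 < e" for e
        using cau[OF that] s D by auto
    qed (rule s)
    then obtain x k where x: "x \<in> S" and k: "strict_mono (k::nat\<Rightarrow>nat)" "(\<lambda>n. d (s (k n)) x) \<longlonglongrightarrow> 0"
      by blast
    have "limitin mtopology (\<sigma> \<circ> k) (r `` {x}) sequentially"
      unfolding limitin_metric
    proof (intro conjI allI impI)
      show "r `` {x} \<in> ?Q" using x by (rule quotientI)
      fix e :: real assume "0 < e"
      then have "\<forall>\<^sub>F n in sequentially. d (s (k n)) x < e"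
        using k(2) by (rule order_tendstoD(2)[rotated])
      then show "\<forall>\<^sub>F n in sequentially. (\<sigma> \<circ> k) n \<in> ?Q \<and> ?D ((\<sigma> \<circ> k) n) (r `` {x}) < e"
        using s D x by (auto elim!: eventually_mono simp: quotientI)
    qed
    \<comment> \<open>A Cauchy sequence converges as soon as a subsequence does, which is why
      \<open>complete\<close> asks for a subsequence only.\<close>
    then have "limitin mtopology \<sigma> (r `` {x}) sequentially"
      by (rule MCauchy_convergent_subsequence[OF \<open>MCauchy \<sigma>\<close> k(1)])
    then show "\<exists>x. limitin mtopology \<sigma> x sequentially" ..
  qed
  have "separable_space mtopology"
  proof -
    have "\<forall>n::nat. \<exists>\<C>. countable \<C> \<and> S \<subseteq> \<Union>\<C> \<and> (\<forall>B\<in>\<C>. \<forall>x\<in>B \<inter> S. \<forall>y\<in>B \<inter> S. d x y < 1 / Suc n)"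
      by (intro allI separable) simp
    from choice[OF this] obtain \<C> where C: "\<forall>n::nat. countable (\<C> n) \<and> S \<subseteq> \<Union>(\<C> n) \<and>
      (\<forall>B\<in>\<C> n. \<forall>x\<in>B \<inter> S. \<forall>y\<in>B \<inter> S. d x y < 1 / Suc n)" ..
    have \<C>: "countable (\<C> n)" "S \<subseteq> \<Union>(\<C> n)" for n
      using C[rule_format, of n] by (rule conjunct1, elim conjE)
    have small: "d x y < 1 / Suc n" if "B \<in> \<C> n" "x \<in> B \<inter> S" "y \<in> B \<inter> S" for n B x y
      using C[rule_format, of n, THEN conjunct2, THEN conjunct2, rule_format, OF that] .
    \<comment> \<open>One point of \<open>S\<close> from each piece that meets \<open>S\<close>.
      Every other point of \<open>S\<close> in a piece of the n-th cover is within 1/(n+1) of it, so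
      these points are dense.\<close>
    define p where "p B = (SOME x. x \<in> B \<inter> S)" for B
    define K where "K = (\<lambda>B. r `` {p B}) ` {B \<in> (\<Union>n. \<C> n). B \<inter> S \<noteq> {}}"
    have p: "p B \<in> B \<inter> S" if "B \<inter> S \<noteq> {}" for B
      using that unfolding p_def by (rule someI_ex[OF ex_in_conv[THEN iffD2]])
    have "countable (\<Union>n. \<C> n)" using \<C>(1) by auto
    then have "countable K" unfolding K_def
      by (intro countable_image) (rule countable_subset[rotated], auto)
    moreover have "K \<subseteq> ?Q" using p by (auto simp: K_def intro!: quotientI)
    moreover have "mtopology closure_of K = ?Q"
    proof -
      have "\<exists>B\<in>K. B \<in> mball A e" if "A \<in> ?Q" "0 < e" for A e
      proof -
        obtain x where x: "x \<in> S" "A = r `` {x}" using rep \<open>A \<in> ?Q\<close> by blast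
        obtain n where n: "1 / Suc n < e" using \<open>0 < e\<close> nat_approx_posE by blast
        obtain B where B: "B \<in> \<C> n" "x \<in> B" using \<C>(2)[of n] x by blast
        then have pB: "p B \<in> B \<inter> S" using p x by blast
        then have "d x (p B) < e" using small[OF B(1), of x "p B"] x B n by auto
        then have "r `` {p B} \<in> mball A e"
          using x pB D by (auto simp: quotientI)
        moreover have "r `` {p B} \<in> K" using B x by (auto simp: K_def)
        ultimately show ?thesis ..
      qed
      then show ?thesis by (auto simp: metric_closure_of)
    qed
    ultimately show ?thesis unfolding separable_space_def by auto
  qed
  with comp show ?thesis
    unfolding complete_separable_metric_def using Metric_space_axioms by blast
qed

section \<open>Convergence in measure\<close>

text \<open>The distance of convergence in measure. Truncation makes the integrand integrable over a
  finite measure for arbitrary measurable functions. Controls use \<open>c = 1\<close>; stopping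
  times use \<open>c = 2\<close>, where the truncation has no effect.\<close>

definition trunc_dist :: "'a measure \<Rightarrow> real \<Rightarrow> ('a \<Rightarrow> 'b::metric_space) \<Rightarrow> ('a \<Rightarrow> 'b) \<Rightarrow> real" where
  "trunc_dist M c f g = (LINT x|M. min c (dist (f x) (g x)))"

lemma Cauchy_if_summable_dist:
  fixes u :: "nat \<Rightarrow> 'b::metric_space"
  assumes "summable (\<lambda>i. dist (u i) (u (Suc i)))"
  shows "Cauchy u"
proof (rule CauchyI')
  fix e :: real assume "0 < e"
  then obtain N where N: "\<And>m n. N \<le> m \<Longrightarrow> norm (\<Sum>i=m..<n. dist (u i) (u (Suc i))) < e"
    using assms unfolding summable_Cauchy by blast
  have le: "dist (u m) (u (m + k)) \<le> (\<Sum>i=m..<m + k. dist (u i) (u (Suc i)))" for m k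
  proof (induction k)
    case (Suc k)
    then show ?case
      using dist_triangle[of "u m" "u (m + Suc k)" "u (m + k)"] by simp
  qed simp
  have "dist (u m) (u n) < e" if "N \<le> m" "m < n" for m n
  proof -
    have "dist (u m) (u n) \<le> (\<Sum>i=m..<n. dist (u i) (u (Suc i)))"
      using le[of m "n - m"] that by simp
    also have "\<dots> < e" using N[OF that(1), of n] by simp
    finally show ?thesis .
  qed
  then show "\<exists>N. \<forall>m\<ge>N. \<forall>n>m. dist (u m) (u n) < e" by blast
qed

context finite_measure
begin

lemma integrable_min_dist [intro]:
  fixes f g :: "'a \<Rightarrow> 'b::{metric_space, second_countable_topology}"
  assumes [measurable]: "f \<in> borel_measurable M" "g \<in> borel_measurable M" and "0 \<le> c"
  shows "integrable M (\<lambda>x. min c (dist (f x) (g x)))"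
  using \<open>0 \<le> c\<close> by (intro integrable_const_bound[where B = c]) auto

lemma trunc_dist_nonneg: "0 \<le> c \<Longrightarrow> 0 \<le> trunc_dist M c f g"
  unfolding trunc_dist_def by (intro integral_nonneg_AE) simp

lemma trunc_dist_commute: "trunc_dist M c f g = trunc_dist M c g f"
  by (simp add: trunc_dist_def dist_commute)

lemma trunc_dist_triangle:
  fixes f g h :: "'a \<Rightarrow> 'b::{metric_space, second_countable_topology}"
  assumes [measurable]: "f \<in> borel_measurable M" "g \<in> borel_measurable M" "h \<in> borel_measurable M"
    and c: "0 \<le> c"
  shows "trunc_dist M c f h \<le> trunc_dist M c f g + trunc_dist M c g h"
proof -
  have "min c (dist (f x) (h x)) \<le> min c (dist (f x) (g x)) + min c (dist (g x) (h x))" for x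
    using dist_triangle[of "f x" "h x" "g x"] c zero_le_dist[of "f x" "g x"] zero_le_dist[of "g x" "h x"]
    by linarith
  then show ?thesis
    unfolding trunc_dist_def using c
    by (subst Bochner_Integration.integral_add[symmetric]) (auto intro!: integral_mono Bochner_Integration.integrable_add)
qed

lemma trunc_dist_eq_0_iff:
  fixes f g :: "'a \<Rightarrow> 'b::{metric_space, second_countable_topology}"
  assumes [measurable]: "f \<in> borel_measurable M" "g \<in> borel_measurable M" and c: "0 < c"
  shows "trunc_dist M c f g = 0 \<longleftrightarrow> (AE x in M. f x = g x)"
proof -
  have "trunc_dist M c f g = 0 \<longleftrightarrow> (AE x in M. min c (dist (f x) (g x)) = 0)"
    unfolding trunc_dist_def using c by (intro integral_nonneg_eq_0_iff_AE) auto
  also have "\<dots> \<longleftrightarrow> (AE x in M. f x = g x)"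
    using c by (intro AE_cong) (auto simp: min_def)
  finally show ?thesis .
qed

lemma trunc_dist_tendsto_0:
  fixes f :: "nat \<Rightarrow> 'a \<Rightarrow> 'b::{metric_space, second_countable_topology}"
  assumes [measurable]: "\<And>n. f n \<in> borel_measurable M" "g \<in> borel_measurable M" and c: "0 < c"
    and lim: "AE x in M. (\<lambda>n. f n x) \<longlonglongrightarrow> g x"
  shows "(\<lambda>n. trunc_dist M c (f n) g) \<longlonglongrightarrow> 0"
proof -
  have "(\<lambda>n. LINT x|M. min c (dist (f n x) (g x))) \<longlonglongrightarrow> (LINT x|M. 0)"
  proof (rule integral_dominated_convergence[where w = "\<lambda>_. c"])
    show "AE x in M. (\<lambda>n. min c (dist (f n x) (g x))) \<longlonglongrightarrow> 0"
      using lim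
    proof eventually_elim
      case (elim x)
      then have "(\<lambda>n. min c (dist (f n x) (g x))) \<longlonglongrightarrow> min c 0"
        by (intro tendsto_min tendsto_const) (simp add: tendsto_dist_iff[symmetric])
      then show ?case using c by simp
    qed
  qed (use c in auto)
  then show ?thesis by (simp add: trunc_dist_def)
qed

text \<open>The argument of Riesz: along a subsequence whose consecutive distances are at most
  2^{-i}, the sum of the truncated distances has a finite integral, so it is finite almost
  everywhere.\<close>

lemma trunc_dist_Cauchy_subsequence:
  fixes f :: "nat \<Rightarrow> 'a \<Rightarrow> 'b::{metric_space, second_countable_topology}"
  assumes meas [measurable]: "\<And>n. f n \<in> borel_measurable M" and c: "0 < c"
    and cauchy: "\<And>e. 0 < e \<Longrightarrow> \<exists>N. \<forall>m\<ge>N. \<forall>n\<ge>N. trunc_dist M c (f m) (f n) < e"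
  obtains k :: "nat \<Rightarrow> nat" where "strict_mono k" "AE x in M. Cauchy (\<lambda>i. f (k i) x)"
proof -
  let ?P = "\<lambda>i n. \<forall>m\<ge>n. trunc_dist M c (f n) (f m) < (1 / 2) ^ i"
  have ex: "\<exists>n>n0. ?P i n" for i n0
  proof -
    have "(0::real) < (1 / 2) ^ i" by simp
    from cauchy[OF this] obtain N where "\<forall>m\<ge>N. \<forall>n\<ge>N. trunc_dist M c (f m) (f n) < (1 / 2) ^ i" ..
    then show ?thesis by (intro exI[of _ "max N (Suc n0)"]) auto
  qed
  have "\<exists>k. \<forall>i. ?P i (k i) \<and> k i < k (Suc i)"
    by (rule dependent_nat_choice) (use ex in blast)+
  then obtain k where k: "\<And>i. ?P i (k i)" "\<And>i. k i < k (Suc i)" by blast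
  have small: "trunc_dist M c (f (k i)) (f (k (Suc i))) \<le> (1 / 2) ^ i" for i
    using k(1)[of i] k(2)[of i] by (simp add: less_imp_le)
  have "(\<integral>\<^sup>+x. (\<Sum>i. ennreal (min c (dist (f (k i) x) (f (k (Suc i)) x)))) \<partial>M)
      = (\<Sum>i. \<integral>\<^sup>+x. ennreal (min c (dist (f (k i) x) (f (k (Suc i)) x))) \<partial>M)"
    by (rule nn_integral_suminf) simp
  also have "\<dots> = (\<Sum>i. ennreal (trunc_dist M c (f (k i)) (f (k (Suc i)))))"
    unfolding trunc_dist_def using c by (subst nn_integral_eq_integral) auto
  also have "\<dots> \<le> (\<Sum>i. ennreal ((1 / 2) ^ i))"
    using small by (intro suminf_le) (auto intro: ennreal_leI)
  also have "\<dots> = ennreal (\<Sum>i. (1 / 2) ^ i)"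
    by (intro suminf_ennreal2) auto
  finally have "(\<integral>\<^sup>+x. (\<Sum>i. ennreal (min c (dist (f (k i) x) (f (k (Suc i)) x)))) \<partial>M) \<noteq> \<infinity>"
    by (auto simp: top_unique)
  then have "AE x in M. (\<Sum>i. ennreal (min c (dist (f (k i) x) (f (k (Suc i)) x)))) \<noteq> \<infinity>"
    by (intro nn_integral_PInf_AE) auto
  then have "AE x in M. Cauchy (\<lambda>i. f (k i) x)"
  proof eventually_elim
    case (elim x)
    let ?d = "\<lambda>i. dist (f (k i) x) (f (k (Suc i)) x)"
    have sum: "summable (\<lambda>i. min c (?d i))"
      using elim c by (intro summable_suminf_not_top) auto
    \<comment> \<open>The summands tend to 0, so they are eventually below \<open>c\<close> and the
      truncation disappears.\<close>
    then have "\<forall>\<^sub>F i in sequentially. min c (?d i) < c"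
      using c by (intro order_tendstoD(2)[OF summable_LIMSEQ_zero]) auto
    then have "\<forall>\<^sub>F i in sequentially. min c (?d i) = ?d i"
      by eventually_elim auto
    then have "summable ?d" using sum summable_cong[of "\<lambda>i. min c (?d i)" ?d] by simp
    then show ?case by (rule Cauchy_if_summable_dist)
  qed
  moreover have "strict_mono k" using k(2) by (simp add: strict_mono_Suc_iff)
  ultimately show thesis using that by blast
qed

text \<open>The limit has to be measurable for the smaller sigma-algebra \<open>N\<close>, which
  need not contain the exceptional null set. The set of points where the subsequence is Cauchy does
  belong to \<open>N\<close>. With a fixed value off this set the modified sequence converges
  everywhere, and its limit is \<open>N\<close>-measurable.\<close>

lemma trunc_dist_complete:
  fixes f :: "nat \<Rightarrow> 'a \<Rightarrow> 'b::polish_space"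
  assumes N: "subalgebra M N" and f: "\<And>n. f n \<in> borel_measurable N" and c: "0 < c"
    and cauchy: "\<And>e. 0 < e \<Longrightarrow> \<exists>N. \<forall>m\<ge>N. \<forall>n\<ge>N. trunc_dist M c (f m) (f n) < e"
  shows "\<exists>g\<in>borel_measurable N. \<exists>k::nat\<Rightarrow>nat. strict_mono k \<and> (\<lambda>n. trunc_dist M c (f (k n)) g) \<longlonglongrightarrow> 0"
proof -
  note fM [measurable] = measurable_from_subalg[OF N f]
  obtain k :: "nat \<Rightarrow> nat" where k: "strict_mono k" "AE x in M. Cauchy (\<lambda>i. f (k i) x)"
    using trunc_dist_Cauchy_subsequence[OF fM c cauchy] by blast
  define h where "h i x = (if Cauchy (\<lambda>i. f (k i) x) then f (k i) x else undefined)" for i x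
  define g where "g x = lim (\<lambda>i. h i x)" for x
  have h: "h i \<in> borel_measurable N" for i
  proof -
    note [measurable] = f
    show ?thesis unfolding h_def by measurable
  qed
  have lim: "(\<lambda>i. h i x) \<longlonglongrightarrow> g x" for x
    unfolding g_def convergent_LIMSEQ_iff[symmetric]
    by (cases "Cauchy (\<lambda>i. f (k i) x)") (auto simp: h_def Cauchy_convergent convergent_const)
  have g: "g \<in> borel_measurable N"
    by (rule borel_measurable_LIMSEQ_metric[OF h lim])
  have "AE x in M. (\<lambda>i. f (k i) x) \<longlonglongrightarrow> g x"
    using k(2)
  proof eventually_elim
    case (elim x)
    then show ?case using lim[of x] by (simp add: h_def)
  qed
  then have "(\<lambda>n. trunc_dist M c (f (k n)) g) \<longlonglongrightarrow> 0"
    using measurable_from_subalg[OF N g] c by (intro trunc_dist_tendsto_0) auto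
  then show ?thesis using g k(1) by blast
qed

end

section \<open>Approximation by a countable algebra\<close>

text \<open>The closure of \<open>\<A>\<close> in \<open>sets M\<close> for the pseudometric given
  by the measure of the symmetric difference.\<close>

definition approximable :: "'a measure \<Rightarrow> 'a set set \<Rightarrow> 'a set set" where
  "approximable M \<A> = {A \<in> sets M. \<forall>e>0. \<exists>B\<in>\<A>. measure M (sym_diff A B) < e}"

text \<open>Complements leave symmetric differences unchanged, and the symmetric difference of two
  unions lies in the union of the symmetric differences. A countable union is approximated by its
  finite partial unions, because the remainders decrease to the empty set and the measure is
  finite.\<close>

lemma (in finite_measure) sigma_algebra_approximable:
  assumes alg: "algebra (space M) \<A>" and sub: "\<A> \<subseteq> sets M"
  shows "sigma_algebra (space M) (approximable M \<A>)"
proof -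
  interpret A: algebra "space M" \<A> by fact
  have un: "A \<union> B \<in> approximable M \<A>" if A: "A \<in> approximable M \<A>" and B: "B \<in> approximable M \<A>" for A B
  proof -
    have [measurable]: "A \<in> sets M" "B \<in> sets M" using A B by (auto simp: approximable_def)
    have "\<exists>C\<in>\<A>. measure M (sym_diff (A \<union> B) C) < e" if "0 < e" for e
    proof -
      from \<open>0 < e\<close> have "0 < e / 2" by simp
      then obtain A' B' where A': "A' \<in> \<A>" "measure M (sym_diff A A') < e / 2"
        and B': "B' \<in> \<A>" "measure M (sym_diff B B') < e / 2"
        using A B unfolding approximable_def by blast
      have [measurable]: "A' \<in> sets M" "B' \<in> sets M" using A' B' sub by auto
      have "measure M (sym_diff (A \<union> B) (A' \<union> B')) \<le> measure M (sym_diff A A' \<union> sym_diff B B')"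
        by (intro finite_measure_mono) auto
      also have "\<dots> \<le> measure M (sym_diff A A') + measure M (sym_diff B B')"
        by (intro measure_Un_le) auto
      also have "\<dots> < e" using A' B' by simp
      finally show ?thesis using A' B' by (intro bexI[of _ "A' \<union> B'"]) auto
    qed
    then show ?thesis by (simp add: approximable_def)
  qed
  have compl: "space M - A \<in> approximable M \<A>" if A: "A \<in> approximable M \<A>" for A
  proof -
    have "A \<subseteq> space M" using A sets.sets_into_space by (auto simp: approximable_def)
    have "\<exists>C\<in>\<A>. measure M (sym_diff (space M - A) C) < e" if "0 < e" for e
    proof -
      obtain B where B: "B \<in> \<A>" "measure M (sym_diff A B) < e"
        using A \<open>0 < e\<close> unfolding approximable_def by blast
      have "sym_diff (space M - A) (space M - B) = sym_diff A B"
        using \<open>A \<subseteq> space M\<close> A.sets_into_space[OF B(1)] by auto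
      then show ?thesis using B by (intro bexI[of _ "space M - B"]) auto
    qed
    then show ?thesis using A by (auto simp: approximable_def)
  qed
  have "{} \<in> approximable M \<A>"
    by (auto simp: approximable_def intro!: bexI[of _ "{}"])
  moreover have "approximable M \<A> \<subseteq> Pow (space M)"
    using sets.sets_into_space by (auto simp: approximable_def)
  ultimately have alg': "algebra (space M) (approximable M \<A>)"
    unfolding algebra_iff_Un using un compl by blast
  interpret algebra "space M" "approximable M \<A>" by fact
  show ?thesis
    unfolding sigma_algebra_iff
  proof (intro conjI allI impI alg')
    fix A :: "nat \<Rightarrow> 'a set" assume ran: "range A \<subseteq> approximable M \<A>"
    then have [measurable]: "A i \<in> sets M" for i by (auto simp: approximable_def)
    have "\<exists>C\<in>\<A>. measure M (sym_diff (\<Union>i. A i) C) < e" if "0 < e" for e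
    proof -
      have "(\<lambda>n. measure M ((\<Union>i. A i) - (\<Union>i<n. A i))) \<longlonglongrightarrow> measure M (\<Inter>n. (\<Union>i. A i) - (\<Union>i<n. A i))"
        by (intro finite_Lim_measure_decseq) (auto simp: decseq_def)
      also have "(\<Inter>n. (\<Union>i. A i) - (\<Union>i<n. A i)) = {}" by blast
      finally have "\<forall>\<^sub>F n in sequentially. measure M ((\<Union>i. A i) - (\<Union>i<n. A i)) < e / 2"
        using \<open>0 < e\<close> by (intro order_tendstoD(2)) auto
      then obtain n where n: "measure M ((\<Union>i. A i) - (\<Union>i<n. A i)) < e / 2"
        using eventually_happens'[OF sequentially_bot] by blast
      have "(\<Union>i<n. A i) \<in> approximable M \<A>" using ran by (intro finite_UN) auto
      moreover from \<open>0 < e\<close> have "0 < e / 2" by simp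
      ultimately obtain B where B: "B \<in> \<A>" "measure M (sym_diff (\<Union>i<n. A i) B) < e / 2"
        unfolding approximable_def by blast
      have [measurable]: "B \<in> sets M" using B sub by auto
      have "measure M (sym_diff (\<Union>i. A i) B) \<le> measure M (((\<Union>i. A i) - (\<Union>i<n. A i)) \<union> sym_diff (\<Union>i<n. A i) B)"
        by (intro finite_measure_mono) auto
      also have "\<dots> \<le> measure M ((\<Union>i. A i) - (\<Union>i<n. A i)) + measure M (sym_diff (\<Union>i<n. A i) B)"
        by (intro measure_Un_le) auto
      also have "\<dots> < e" using n B by simp
      finally show ?thesis using B by blast
    qed
    then show "\<Union>(range A) \<in> approximable M \<A>" by (simp add: approximable_def)
  qed
qed

lemma countable_generated_algebra:
  assumes "countable \<C>" and sub: "\<C> \<subseteq> sets M"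
  obtains \<A> where "countable \<A>" "\<C> \<subseteq> \<A>" "\<A> \<subseteq> sets M" "algebra (space M) \<A>"
proof -
  \<comment> \<open>One round of complements and binary unions, iterated countably often. Keeping
    \<open>X\<close> makes the rounds increase, so any two sets occur in a common round. The empty
    set is added at the start since \<open>\<C>\<close> may be empty.\<close>
  define G where "G X = X \<union> (\<lambda>A. space M - A) ` X \<union> (\<lambda>(A, B). A \<union> B) ` (X \<times> X)" for X
  define \<A> where "\<A> = (\<Union>n. (G ^^ n) (insert {} \<C>))"
  have mono: "(G ^^ m) X \<subseteq> (G ^^ n) X" if "m \<le> n" for m n X
    using that by (induction rule: dec_induct) (auto simp: G_def)
  have "countable ((G ^^ n) (insert {} \<C>))" for n
    using assms by (induction n) (auto simp: G_def)
  then have "countable \<A>" by (simp add: \<A>_def)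
  moreover have "\<C> \<subseteq> \<A>" using UN_upper[of 0 UNIV "\<lambda>n. (G ^^ n) (insert {} \<C>)"] by (auto simp: \<A>_def)
  moreover have "(G ^^ n) (insert {} \<C>) \<subseteq> sets M" for n
    using sub by (induction n) (auto simp: G_def)
  then have sets: "\<A> \<subseteq> sets M" by (auto simp: \<A>_def)
  moreover have "algebra (space M) \<A>"
    unfolding algebra_iff_Un
  proof (intro conjI ballI)
    show "\<A> \<subseteq> Pow (space M)" using sets sets.sets_into_space by blast
    show "{} \<in> \<A>" using UN_upper[of 0 UNIV "\<lambda>n. (G ^^ n) (insert {} \<C>)"] by (auto simp: \<A>_def)
    fix A assume "A \<in> \<A>"
    then obtain m where m: "A \<in> (G ^^ m) (insert {} \<C>)" by (auto simp: \<A>_def)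
    then have "space M - A \<in> (G ^^ Suc m) (insert {} \<C>)" by (auto simp: G_def)
    then show "space M - A \<in> \<A>" unfolding \<A>_def by blast
    fix B assume "B \<in> \<A>"
    then obtain n where n: "B \<in> (G ^^ n) (insert {} \<C>)" by (auto simp: \<A>_def)
    have "A \<in> (G ^^ max m n) (insert {} \<C>)" "B \<in> (G ^^ max m n) (insert {} \<C>)"
      using m n mono[of m "max m n"] mono[of n "max m n"] by auto
    then have "A \<union> B \<in> (G ^^ Suc (max m n)) (insert {} \<C>)" by (auto simp: G_def)
    then show "A \<union> B \<in> \<A>" unfolding \<A>_def by blast
  qed
  ultimately show thesis using that by blast
qed

text \<open>The empty set approximates every null set. Thus all null sets become approximable
  without enlarging the countable family, and a sigma-algebra generated by \<open>\<C>\<close> and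
  null sets is covered as a whole.\<close>

lemma (in finite_measure) countable_approximation:
  assumes "countable \<C>" "\<C> \<subseteq> sets M"
  obtains \<A> where "countable \<A>" "\<A> \<subseteq> sets M" "sigma_algebra (space M) (approximable M \<A>)"
    "\<C> \<subseteq> approximable M \<A>" "null_sets M \<subseteq> approximable M \<A>"
proof -
  obtain \<A> where \<A>: "countable \<A>" "\<C> \<subseteq> \<A>" "\<A> \<subseteq> sets M" "algebra (space M) \<A>"
    using countable_generated_algebra[OF assms] by blast
  interpret A: algebra "space M" \<A> by fact
  have "\<C> \<subseteq> approximable M \<A>"
    proof
    fix A assume "A \<in> \<C>"
    then show "A \<in> approximable M \<A>"
      using assms \<A>(2) by (auto simp: approximable_def intro!: bexI[of _ A])
  qed
  moreover have "null_sets M \<subseteq> approximable M \<A>"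
    by (auto simp: approximable_def measure_eq_0_null_sets intro!: bexI[of _ "{}"])
  ultimately show thesis using that \<A> sigma_algebra_approximable by blast
qed

text \<open>A function is coded by a finite list from \<open>\<A>\<close> approximating its preimages of small balls
  around the first points of a dense sequence: off a small set, functions with the same code are
  uniformly close.\<close>

lemma (in finite_measure) trunc_dist_separable:
  fixes S :: "('a \<Rightarrow> 'b::{metric_space, second_countable_topology}) set"
  assumes \<A>: "countable \<A>" "\<A> \<subseteq> sets M" and c: "0 < c" and e: "0 < e"
    and S: "\<And>f U. f \<in> S \<Longrightarrow> open U \<Longrightarrow> f -` U \<inter> space M \<in> approximable M \<A>"
  shows "\<exists>\<C>. countable \<C> \<and> S \<subseteq> \<Union>\<C> \<and>
    (\<forall>B\<in>\<C>. \<forall>f\<in>B \<inter> S. \<forall>g\<in>B \<inter> S. trunc_dist M c f g < e)"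
proof -
  obtain D :: "'b set" where D: "countable D" "\<And>X. open X \<Longrightarrow> X \<noteq> {} \<Longrightarrow> \<exists>d\<in>D. d \<in> X"
    using countable_dense_setE by blast
  have "D \<noteq> {}" using D(2)[of UNIV] by auto
  define u where "u = from_nat_into D"
  have u: "\<exists>i. y \<in> ball (u i) \<delta>" if "0 < \<delta>" for y \<delta>
    using D(2)[of "ball y \<delta>"] that from_nat_into_surj[OF D(1)] by (force simp: u_def dist_commute)
  define m where "m = measure M (space M)"
  \<comment> \<open>Off the bad sets two functions with a common code differ by less than
    \<open>2 * \<delta>\<close>, on a space of mass \<open>m\<close>. Each of the two bad sets has
    measure below \<open>2 * \<delta>\<close> and costs at most \<open>c\<close> per unit of mass.
    The summand 1 keeps the denominator positive and the final inequality strict.\<close>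
  define \<delta> where "\<delta> = e / (2 * m + 4 * c + 1)"
  have "0 \<le> m" by (simp add: m_def)
  then have "0 < 2 * m + 4 * c + 1" using c by simp
  then have \<delta>: "0 < \<delta>" and "\<delta> * (2 * m + 4 * c + 1) = e" using e by (simp_all add: \<delta>_def)
  then have \<delta>2: "2 * \<delta> * m + 4 * \<delta> * c < e" by (simp add: algebra_simps)
  define A where "A f i = f -` ball (u i) \<delta> \<inter> space M" for f :: "'a \<Rightarrow> 'b" and i
  have fS: "f \<in> borel_measurable M" if "f \<in> S" for f
    using S[OF that] by (intro borel_measurableI) (auto simp: approximable_def)
  have AM: "A f i \<in> sets M" if "f \<in> S" for f i
    using S[OF that, of "ball (u i) \<delta>"] by (auto simp: A_def approximable_def)
  \<comment> \<open>Outside this set the value of \<open>f\<close> lies in one of the listed balls,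
    and membership in \<open>Bs ! i\<close> tells exactly whether it lies in the i-th.\<close>
  define bad where "bad f Bs = (space M - (\<Union>i<length Bs. A f i)) \<union> (\<Union>i<length Bs. sym_diff (A f i) (Bs ! i))"
    for f :: "'a \<Rightarrow> 'b" and Bs
  have bad [measurable]: "bad f Bs \<in> sets M" if "f \<in> S" "Bs \<in> lists \<A>" for f Bs
    unfolding bad_def using that AM \<A>(2) by (intro sets.Un sets.Diff sets.finite_UN) (auto simp: in_lists_conv_set)
  define good where "good Bs = {f \<in> S. measure M (bad f Bs) < 2 * \<delta>}" for Bs
  have "S \<subseteq> \<Union>(good ` lists \<A>)"
  proof
    fix f assume f: "f \<in> S"
    note [measurable] = AM[OF f]
    have "(\<lambda>n. measure M (space M - (\<Union>i<n. A f i))) \<longlonglongrightarrow> measure M (\<Inter>n. space M - (\<Union>i<n. A f i))"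
      by (intro finite_Lim_measure_decseq) (auto simp: decseq_def)
    also have "(\<Inter>n. space M - (\<Union>i<n. A f i)) = {}"
    proof (rule equals0I)
      fix x assume x: "x \<in> (\<Inter>n. space M - (\<Union>i<n. A f i))"
      obtain i where "f x \<in> ball (u i) \<delta>" using u[OF \<delta>] by blast
      moreover have "x \<in> space M - (\<Union>j<Suc i. A f j)" using x by (rule INT_D) simp
      ultimately show False by (auto simp: A_def)
    qed
    finally have "\<forall>\<^sub>F n in sequentially. measure M (space M - (\<Union>i<n. A f i)) < \<delta>"
      using \<delta> by (intro order_tendstoD(2)) auto
    then obtain n where n: "measure M (space M - (\<Union>i<n. A f i)) < \<delta>"
      using eventually_happens'[OF sequentially_bot] by blast
    \<comment> \<open>The \<open>n\<close> errors add up to at most \<open>\<delta>\<close>;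
      \<open>Suc n\<close> instead of \<open>n\<close> covers the case \<open>n = 0\<close>.\<close>
    have "0 < \<delta> / Suc n" using \<delta> by simp
    then have "\<forall>i. \<exists>B\<in>\<A>. measure M (sym_diff (A f i) B) < \<delta> / Suc n"
      using S[OF f, OF open_ball] unfolding A_def approximable_def by blast
    then obtain B where B: "\<And>i. B i \<in> \<A>" "\<And>i. measure M (sym_diff (A f i) (B i)) < \<delta> / Suc n"
      by metis
    let ?Bs = "map B [0..<n]"
    have [measurable]: "B i \<in> sets M" for i using B \<A> by auto
    have "measure M (bad f ?Bs) \<le> measure M (space M - (\<Union>i<n. A f i))
        + measure M (\<Union>i<n. sym_diff (A f i) (B i))"
      unfolding bad_def by (simp, intro measure_Un_le) auto
    also have "measure M (\<Union>i<n. sym_diff (A f i) (B i)) \<le> (\<Sum>i<n. measure M (sym_diff (A f i) (B i)))"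
      by (intro finite_measure_subadditive_finite) auto
    also have "\<dots> \<le> (\<Sum>i<n. \<delta> / Suc n)"
      using B(2) by (intro sum_mono) (auto intro: less_imp_le)
    also have "\<dots> \<le> \<delta>" using \<delta> by (simp add: field_simps)
    finally have "f \<in> good ?Bs" using n f by (simp add: good_def)
    moreover have "?Bs \<in> lists \<A>" using B by (auto simp: in_lists_conv_set)
    ultimately show "f \<in> \<Union>(good ` lists \<A>)" by blast
  qed
  moreover have "countable (good ` lists \<A>)" using \<A> by simp
  moreover have "trunc_dist M c f g < e" if Bs: "Bs \<in> lists \<A>" and f: "f \<in> good Bs" and g: "g \<in> good Bs" for Bs f g
  proof -
    have [measurable]: "f \<in> borel_measurable M" "g \<in> borel_measurable M" and fg: "f \<in> S" "g \<in> S"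
      using f g fS by (auto simp: good_def)
    note bad[OF fg(1) Bs, measurable] bad[OF fg(2) Bs, measurable]
    have int: "integrable M (indicat_real (bad f Bs))" "integrable M (indicat_real (bad g Bs))"
      by (intro integrable_real_indicator; simp add: less_top[symmetric])+
    let ?I = "\<lambda>x. indicat_real (bad f Bs) x + indicat_real (bad g Bs) x"
    have "trunc_dist M c f g \<le> (LINT x|M. 2 * \<delta> + c * ?I x)"
      unfolding trunc_dist_def
    proof (rule integral_mono)
      show "integrable M (\<lambda>x. min c (dist (f x) (g x)))" using c by auto
      show "min c (dist (f x) (g x)) \<le> 2 * \<delta> + c * ?I x" if "x \<in> space M" for x
      proof (cases "x \<in> bad f Bs \<or> x \<in> bad g Bs")
        case True
        then show ?thesis using c \<delta> by (auto simp: min_le_iff_disj indicator_def)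
      next
        case False
        then have f: "x \<notin> bad f Bs" and g: "x \<notin> bad g Bs" by simp_all
        \<comment> \<open>The ball that contains the value of \<open>f\<close> is read off the code,
          and the code hands it on to \<open>g\<close>; so both values lie in the same ball.\<close>
        from f that obtain i where i: "i < length Bs" "x \<in> A f i" unfolding bad_def by blast
        with f have "x \<in> Bs ! i" unfolding bad_def by blast
        with g i(1) have "x \<in> A g i" unfolding bad_def by blast
        then have "dist (u i) (f x) < \<delta>" "dist (u i) (g x) < \<delta>"
          using i by (auto simp: A_def)
        then have "dist (f x) (g x) < 2 * \<delta>"
          using dist_triangle3[of "f x" "g x" "u i"] by simp
        moreover have "0 \<le> c * ?I x" using c by simp
        ultimately show ?thesis by linarith
      qed
    qed (use int in \<open>intro Bochner_Integration.integrable_add integrable_mult_right integrable_const\<close>)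
    also have "\<dots> = 2 * \<delta> * m + c * (measure M (bad f Bs) + measure M (bad g Bs))"
      using int by (simp add: m_def)
    also have "\<dots> \<le> 2 * \<delta> * m + c * (4 * \<delta>)"
      using f g c by (intro add_left_mono mult_left_mono) (auto simp: good_def)
    also have "\<dots> < e" using \<delta>2 by (simp add: mult_ac)
    finally show ?thesis .
  qed
  ultimately show ?thesis by (intro exI[of _ "good ` lists \<A>"] conjI) (assumption, assumption, blast)
qed

section \<open>Sigma-algebras generated by processes on path space\<close>

text \<open>A common form for the past, given by the values at times in \<open>T\<close>, and for
  the future after \<open>s\<close>, given by the increments from \<open>s\<close>.\<close>

definition generated_by ::
    "(real \<Rightarrow> (real \<Rightarrow> real^'d) \<Rightarrow> real^'d) \<Rightarrow> real set \<Rightarrow> (real \<Rightarrow> real^'d) measure" where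
  "generated_by X T = sigma path_space {X r -` B \<inter> path_space | r B. r \<in> T \<and> B \<in> sets borel}"

abbreviation (input) canonical_process :: "real \<Rightarrow> (real \<Rightarrow> real^'d) \<Rightarrow> real^'d" where
  "canonical_process r \<omega> \<equiv> \<omega> r"

abbreviation increment :: "real \<Rightarrow> real \<Rightarrow> (real \<Rightarrow> real^'d) \<Rightarrow> real^'d" where
  "increment s r \<omega> \<equiv> \<omega> r - \<omega> s"

lemma canonical_filtration_eq: "canonical_filtration s = generated_by canonical_process {0..s}"
  by (simp add: canonical_filtration_def generated_by_def)

lemma sets_generated_by:
  "sets (generated_by X T) = sigma_sets path_space {X r -` B \<inter> path_space | r B. r \<in> T \<and> B \<in> sets borel}"
  unfolding generated_by_def by (rule sets_measure_of) auto

lemma space_generated_by [simp]: "space (generated_by X T) = path_space"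
  unfolding generated_by_def by (rule space_measure_of) auto

lemma measurable_generated_by: "r \<in> T \<Longrightarrow> X r \<in> borel_measurable (generated_by X T)"
  by (rule measurableI) (auto simp: sets_generated_by)

lemma generated_by_least:
  assumes "space N = path_space" "\<And>r. r \<in> T \<Longrightarrow> X r \<in> borel_measurable N"
  shows "sets (generated_by X T) \<subseteq> sets N"
  unfolding sets_generated_by assms(1)[symmetric]
  using assms(2) by (intro sets.sigma_sets_subset) (auto intro: measurable_sets)

lemma generated_by_mono: "T \<subseteq> T' \<Longrightarrow> sets (generated_by X T) \<subseteq> sets (generated_by X T')"
  by (intro generated_by_least) (auto intro: measurable_generated_by)

text \<open>Two finite sets of times have a finite union, so the events that depend on finitely many
  times form a pi-system. Independence need only be checked on such events.\<close>

lemma Int_stable_Union_generated_by: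
  "Int_stable (\<Union>F\<in>{F. finite F \<and> F \<subseteq> T}. sets (generated_by X F))"
proof (rule Int_stableI, clarify)
  fix A B F G assume "A \<in> sets (generated_by X F)" "B \<in> sets (generated_by X G)"
    "finite F" "F \<subseteq> T" "finite G" "G \<subseteq> T"
  then have "A \<in> sets (generated_by X (F \<union> G))" "B \<in> sets (generated_by X (F \<union> G))"
    using generated_by_mono[of F "F \<union> G" X] generated_by_mono[of G "F \<union> G" X] by auto
  then show "A \<inter> B \<in> (\<Union>F\<in>{F. finite F \<and> F \<subseteq> T}. sets (generated_by X F))"
    using \<open>finite F\<close> \<open>F \<subseteq> T\<close> \<open>finite G\<close> \<open>G \<subseteq> T\<close> by (intro UN_I[of "F \<union> G"]) auto
qed

lemma generated_by_subset_finite: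
  fixes X :: "real \<Rightarrow> (real \<Rightarrow> real^'d) \<Rightarrow> real^'d"
  shows "sets (generated_by X T) \<subseteq> sigma_sets path_space (\<Union>F\<in>{F. finite F \<and> F \<subseteq> T}. sets (generated_by X F))"
  unfolding sets_generated_by[of X T]
proof (rule sigma_sets_subseteq, clarify)
  fix r B assume "r \<in> T" "B \<in> sets (borel :: (real^'d) measure)"
  then show "X r -` B \<inter> path_space \<in> (\<Union>F\<in>{F. finite F \<and> F \<subseteq> T}. sets (generated_by X F))"
    by (intro UN_I[of "{r}"]) (auto simp: sets_generated_by)
qed

lemma sets_canonical_sigma_inf:
  "sets (canonical_sigma_inf :: (real \<Rightarrow> real^'d) measure) = sets (generated_by canonical_process {0..})"
proof
  let ?F = "canonical_filtration :: real \<Rightarrow> (real \<Rightarrow> real^'d) measure"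
  have "(\<Union>s\<in>{0..}. sets (?F s)) \<subseteq> Pow path_space"
    using sets.sets_into_space by (fastforce simp: canonical_filtration_eq)
  then have eq: "sets canonical_sigma_inf = sigma_sets path_space (\<Union>s\<in>{0..}. sets (?F s))"
    unfolding canonical_sigma_inf_def by (rule sets_measure_of)
  show "sets (canonical_sigma_inf :: (real \<Rightarrow> real^'d) measure) \<subseteq> sets (generated_by canonical_process {0..})"
    unfolding eq space_generated_by[of canonical_process "{0..}", symmetric] canonical_filtration_eq
    by (intro sets.sigma_sets_subset UN_least generated_by_mono) auto
  show "sets (generated_by canonical_process {0..}) \<subseteq> sets (canonical_sigma_inf :: (real \<Rightarrow> real^'d) measure)"
    unfolding eq sets_generated_by[of _ "{0..}"]
  proof (intro sigma_sets_subseteq subsetI)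
    fix A assume "A \<in> {canonical_process r -` B \<inter> path_space | r B. r \<in> {0..} \<and> B \<in> sets (borel :: (real^'d) measure)}"
    then obtain r B where "0 \<le> r" "B \<in> sets borel" "A = canonical_process r -` B \<inter> path_space" by auto
    then show "A \<in> (\<Union>s\<in>{0..}. sets (?F s))"
      by (intro UN_I[of r]) (auto simp: canonical_filtration_eq sets_generated_by)
  qed
qed

lemma space_canonical_sigma_inf [simp]: "space canonical_sigma_inf = path_space"
  using sets_eq_imp_space_eq[OF sets_canonical_sigma_inf] by simp

lemma canonical_filtration_subset_inf: "sets (canonical_filtration s) \<subseteq> sets canonical_sigma_inf"
  unfolding canonical_filtration_eq sets_canonical_sigma_inf by (rule generated_by_mono) auto

lemma path_space_continuous:
  assumes "\<omega> \<in> path_space" "0 \<le> r" "\<And>n. 0 \<le> q n" "q \<longlonglongrightarrow> r"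
  shows "(\<lambda>n. \<omega> (q n)) \<longlonglongrightarrow> \<omega> r"
  using assms by (intro continuous_on_tendsto_compose[of "{0..}" \<omega>]) (auto simp: path_space_def)

text \<open>By continuity of the paths, evaluation at any time is a limit of evaluations at
  nonnegative rational times, and the Borel sets of the state space have a countable basis.\<close>

lemma canonical_sigma_inf_countably_generated:
  obtains \<C> :: "(real \<Rightarrow> real^'d) set set"
  where "countable \<C>" "\<C> \<subseteq> sets canonical_sigma_inf" "sets canonical_sigma_inf \<subseteq> sigma_sets path_space \<C>"
proof -
  obtain \<B> :: "(real^'d) set set" where \<B>: "countable \<B>" "topological_basis \<B>"
    using ex_countable_basis by blast
  \<comment> \<open>The first point at or after \<open>r\<close> on the grid of mesh 1/(n+1): it is
    nonnegative, belongs to \<open>T\<close> and exceeds \<open>r\<close> by at most the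
    mesh.\<close>
  define q where "q r n = real (nat \<lceil>r * real (Suc n)\<rceil>) / real (Suc n)" for r :: real and n
  define T where "T = range (\<lambda>(k::nat, n). real k / real (Suc n))"
  define \<C> where "\<C> = (\<lambda>(r, B). canonical_process r -` B \<inter> path_space) ` (T \<times> \<B>)"
  have T: "countable T" "T \<subseteq> {0..}" by (auto simp: T_def)
  have "countable \<C>" using T \<B> by (auto simp: \<C>_def)
  moreover have "\<C> \<subseteq> sets canonical_sigma_inf"
  proof
    fix A assume "A \<in> \<C>"
    then obtain r B where "r \<in> T" "B \<in> \<B>" "A = canonical_process r -` B \<inter> path_space"
      by (auto simp: \<C>_def)
    then show "A \<in> sets canonical_sigma_inf"
      using T(2) topological_basis_open[OF \<B>(2), of B] unfolding sets_canonical_sigma_inf sets_generated_by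
      by (auto intro!: sigma_sets.Basic exI[of _ r] exI[of _ B])
  qed
  moreover have "sets canonical_sigma_inf \<subseteq> sigma_sets path_space \<C>"
  proof -
    have \<C>: "\<C> \<subseteq> Pow path_space" by (auto simp: \<C>_def)
    let ?N = "sigma path_space \<C>"
    have space: "space ?N = path_space" using \<C> by (rule space_measure_of)
    have sets: "sets ?N = sigma_sets path_space \<C>" using \<C> by (rule sets_measure_of)
    have T: "canonical_process r \<in> borel_measurable ?N" if "r \<in> T" for r
      unfolding borel_eq_countable_basis[OF \<B>]
    proof (rule measurable_sigma_sets)
      show "canonical_process r -` B \<inter> space ?N \<in> sets ?N" if "B \<in> \<B>" for B
        unfolding space sets using that \<open>r \<in> T\<close> by (auto simp: \<C>_def intro!: sigma_sets.Basic)
    qed auto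
    have "canonical_process r \<in> borel_measurable ?N" if "0 \<le> r" for r
    proof (rule borel_measurable_LIMSEQ_metric)
      show "canonical_process (q r n) \<in> borel_measurable ?N" for n
        by (rule T) (auto simp: T_def q_def)
      have "q r \<longlonglongrightarrow> r"
      proof (rule real_tendsto_sandwich)
        show "\<forall>\<^sub>F n in sequentially. r \<le> q r n"
          using real_nat_ceiling_ge by (intro always_eventually allI) (simp add: q_def pos_le_divide_eq)
        show "\<forall>\<^sub>F n in sequentially. q r n \<le> r + 1 / real (Suc n)"
        proof (intro always_eventually allI)
          fix n
          have "real (nat \<lceil>r * real (Suc n)\<rceil>) \<le> r * real (Suc n) + 1"
            using that by (simp add: of_nat_nat ceiling_correct le_of_int_ceiling less_imp_le)
          then have "q r n \<le> (r * real (Suc n) + 1) / real (Suc n)"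
            unfolding q_def by (intro divide_right_mono) auto
          then show "q r n \<le> r + 1 / real (Suc n)" by (simp add: add_divide_distrib)
        qed
        show "(\<lambda>n. r + 1 / real (Suc n)) \<longlonglongrightarrow> r"
          using tendsto_add[OF tendsto_const LIMSEQ_inverse_real_of_nat, of r] by (simp add: inverse_eq_divide)
      qed simp
      moreover have "0 \<le> q r n" for n by (simp add: q_def)
      ultimately show "(\<lambda>n. \<omega> (q r n)) \<longlonglongrightarrow> \<omega> r" if "\<omega> \<in> space ?N" for \<omega>
        using that \<open>0 \<le> r\<close> unfolding space by (intro path_space_continuous)
    qed
    then have "sets canonical_sigma_inf \<subseteq> sets ?N"
      unfolding sets_canonical_sigma_inf using space by (intro generated_by_least) auto
    then show ?thesis using sets by simp
  qed
  ultimately show thesis using that by blast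
qed

section \<open>Independent increments\<close>

locale wiener = prob_space P for P :: "(real \<Rightarrow> real^'d) measure" +
  assumes wiener: "wiener_measure P"
begin

lemma space_P [simp]: "space P = path_space"
  using wiener by (simp add: wiener_measure_def)

text \<open>The Gaussian law of an increment includes its measurability, and since paths start at 0,
  the increment from time 0 is the evaluation itself. The law is given only for a positive time
  step; at time 0 the evaluation is constant.\<close>

lemma measurable_canonical_process [measurable]:
  assumes "0 \<le> r" shows "canonical_process r \<in> borel_measurable P"
proof (cases "r = 0")
  case True
  have "(\<lambda>\<omega>. 0) \<in> borel_measurable P" by simp
  then show ?thesis unfolding True by (rule measurable_cong[THEN iffD1, rotated]) (simp add: path_space_def)
next
  case False
  with assms have "0 < r" by simp
  have "(\<lambda>\<omega>. \<omega> r \<bullet> b) \<in> borel_measurable P" if b: "b \<in> Basis" for b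
  proof -
    obtain i where i: "b = axis i 1" using b by (auto simp: Basis_vec_def)
    have "distributed P lborel (\<lambda>\<omega>. (\<omega> r - \<omega> 0) $ i) (\<lambda>x. ennreal (normal_density 0 (sqrt (r - 0)) x))"
      using wiener \<open>0 < r\<close> unfolding wiener_measure_def by blast
    then have "(\<lambda>\<omega>. (\<omega> r - \<omega> 0) $ i) \<in> borel_measurable P"
      using distributed_measurable by fastforce
    then show ?thesis
      by (rule measurable_cong[THEN iffD1, rotated]) (simp add: path_space_def i inner_axis)
  qed
  then show ?thesis by (rule borel_measurable_euclidean_space[THEN iffD2, OF ballI])
qed

lemma generated_by_events:
  assumes "\<And>r. r \<in> T \<Longrightarrow> X r \<in> borel_measurable P"
  shows "sets (generated_by X T) \<subseteq> events"
  using assms by (intro generated_by_least) auto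

lemma canonical_sigma_inf_events: "sets canonical_sigma_inf \<subseteq> events"
  unfolding sets_canonical_sigma_inf by (intro generated_by_events) auto

lemma canonical_filtration_events: "sets (canonical_filtration s) \<subseteq> events"
  using canonical_filtration_subset_inf canonical_sigma_inf_events by blast

lemma increment_events: "0 \<le> s \<Longrightarrow> sets (generated_by (increment s) {s..}) \<subseteq> events"
  by (intro generated_by_events borel_measurable_diff measurable_canonical_process) auto

text \<open>All times involved are merged into one partition. Values at times up to \<open>s\<close>
  are sums of increments before the index of \<open>s\<close>, and increments from \<open>s\<close>
  are sums of increments after it. These are two disjoint groups of an independent family.\<close>

lemma indep_finite_past_future:
  assumes s: "0 \<le> s" and F: "finite F" "F \<subseteq> {0..s}" and G: "finite G" "G \<subseteq> {s..}"
    and A: "A \<in> sets (generated_by canonical_process F)" and B: "B \<in> sets (generated_by (increment s) G)"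
  shows "prob (A \<inter> B) = prob A * prob B"
proof -
  \<comment> \<open>The point 0 lets the values telescope from the start of the path; the point
    \<open>s\<close> makes the cut between past and future fall on the grid.\<close>
  define S where "S = insert 0 (insert s (F \<union> G))"
  define l where "l = sorted_list_of_set S"
  define t where "t k = l ! k" for k
  \<comment> \<open>The number of increments, one less than the number of grid points
    \<open>t 0, ..., t n\<close>.\<close>
  define n where "n = card S - 1"
  have S: "finite S" "0 \<in> S" using F G by (auto simp: S_def)
  then have "0 < card S" by (auto simp: card_gt_0_iff)
  with S have len: "length l = Suc n" "set l = S" and srt: "sorted_wrt (<) l"
    by (auto simp: l_def n_def)
  have mono: "strict_mono_on {..n} t"
    unfolding strict_mono_on_def t_def using sorted_wrt_nth_less[OF srt] len by auto
  have le_iff: "t j \<le> t k \<longleftrightarrow> j \<le> k" if "j \<le> n" "k \<le> n" for j k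
    using strict_mono_on_less_eq[OF mono] that by auto
  have ex: "\<exists>k\<le>n. t k = u" if "u \<in> S" for u
    using that len by (metis in_set_conv_nth less_Suc_eq_le t_def)
  have pos: "0 \<le> t k" if "k \<le> n" for k
  proof -
    have "t k \<in> S" using that len by (metis le_imp_less_Suc nth_mem t_def)
    then show ?thesis using s F G by (auto simp: S_def)
  qed
  have t0: "t 0 = 0"
  proof -
    obtain k where "k \<le> n" "t k = 0" using ex[of 0] by (auto simp: S_def)
    then have "t 0 \<le> 0" using le_iff[of 0 k] by simp
    then show ?thesis using pos[of 0] by simp
  qed
  obtain m where m: "m \<le> n" "t m = s" using ex[of s] by (auto simp: S_def)
  define X :: "nat \<times> 'd \<Rightarrow> (real \<Rightarrow> real^'d) \<Rightarrow> real"
    where "X = (\<lambda>(k, i) \<omega>. (\<omega> (t (Suc k)) - \<omega> (t k)) $ i)"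
  have "indep_vars (\<lambda>_. borel) X ({..<n} \<times> UNIV)"
    unfolding X_def using wiener mono pos unfolding wiener_measure_def by auto
  then have ind: "indep_var
      (PiM ({..<m} \<times> UNIV) (\<lambda>_. borel)) (\<lambda>\<omega>. restrict (\<lambda>p. X p \<omega>) ({..<m} \<times> UNIV))
      (PiM ({m..<n} \<times> UNIV) (\<lambda>_. borel)) (\<lambda>\<omega>. restrict (\<lambda>p. X p \<omega>) ({m..<n} \<times> UNIV))"
    by (rule indep_var_restrict) (use m in auto)
  \<comment> \<open>The sigma-algebra generated by all coordinates of the increments with index in
    \<open>K\<close>. The independence of the two groups is a statement about
    \<open>V {..<m}\<close> and \<open>V {m..<n}\<close>.\<close>
  define V where "V K = vimage_algebra path_space (\<lambda>\<omega>. restrict (\<lambda>p. X p \<omega>) (K \<times> UNIV)) (PiM (K \<times> UNIV) (\<lambda>_. borel))"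
    for K :: "nat set"
  have V: "(\<lambda>\<omega>. \<omega> (t k) - \<omega> (t j)) \<in> borel_measurable (V K)" if "{j..<k} \<subseteq> K" "j \<le> k" for j k K
  proof (rule borel_measurable_euclidean_space[THEN iffD2, OF ballI])
    fix b :: "real^'d" assume "b \<in> Basis"
    then obtain i where i: "b = axis i 1" by (auto simp: Basis_vec_def)
    have "(\<lambda>x. \<Sum>l=j..<k. x (l, i) :: real) \<in> borel_measurable (PiM (K \<times> UNIV) (\<lambda>_. borel))"
      using that by (intro borel_measurable_sum measurable_component_singleton) auto
    moreover have "(\<lambda>\<omega>. restrict (\<lambda>p. X p \<omega>) (K \<times> UNIV)) \<in> V K \<rightarrow>\<^sub>M PiM (K \<times> UNIV) (\<lambda>_. borel)"
      unfolding V_def by (rule measurable_vimage_algebra1) (auto simp: space_PiM)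
    ultimately have "(\<lambda>\<omega>. \<Sum>l=j..<k. restrict (\<lambda>p. X p \<omega>) (K \<times> UNIV) (l, i)) \<in> borel_measurable (V K)"
      by (rule measurable_compose[rotated])
    moreover have "(\<Sum>l=j..<k. restrict (\<lambda>p. X p \<omega>) (K \<times> UNIV) (l, i)) = (\<omega> (t k) - \<omega> (t j)) \<bullet> b" for \<omega>
    proof -
      have "(\<Sum>l=j..<k. restrict (\<lambda>p. X p \<omega>) (K \<times> UNIV) (l, i)) = (\<Sum>l=j..<k. \<omega> (t (Suc l)) $ i - \<omega> (t l) $ i)"
        using that by (intro sum.cong) (auto simp: X_def)
      also have "\<dots> = \<omega> (t k) $ i - \<omega> (t j) $ i"
        by (rule sum_Suc_diff') fact
      finally show ?thesis by (simp add: i inner_axis)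
    qed
    ultimately show "(\<lambda>\<omega>. (\<omega> (t k) - \<omega> (t j)) \<bullet> b) \<in> borel_measurable (V K)" by simp
  qed
  have spV [simp]: "space (V K) = path_space" for K by (simp add: V_def)
  have "sets (generated_by canonical_process F) \<subseteq> sets (V {..<m})"
  proof (rule generated_by_least)
    fix r assume r: "r \<in> F"
    then obtain k where k: "k \<le> n" "t k = r" using ex[of r] by (auto simp: S_def)
    have "t k \<le> t m" using r F k m by auto
    then have "k \<le> m" using le_iff k m by blast
    then have "(\<lambda>\<omega>. \<omega> (t k) - \<omega> (t 0)) \<in> borel_measurable (V {..<m})" by (intro V) auto
    then show "canonical_process r \<in> borel_measurable (V {..<m})"
      by (rule measurable_cong[THEN iffD1, rotated]) (simp add: path_space_def t0 k)
  qed simp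
  then have A': "A \<in> sets (V {..<m})" using A by auto
  have "sets (generated_by (increment s) G) \<subseteq> sets (V {m..<n})"
  proof (rule generated_by_least)
    fix r assume r: "r \<in> G"
    then obtain k where k: "k \<le> n" "t k = r" using ex[of r] by (auto simp: S_def)
    have "t m \<le> t k" using r G k m by auto
    then have "m \<le> k" using le_iff k m by blast
    then have "(\<lambda>\<omega>. \<omega> (t k) - \<omega> (t m)) \<in> borel_measurable (V {m..<n})" using k by (intro V) auto
    then show "increment s r \<in> borel_measurable (V {m..<n})" using k m by simp
  qed simp
  then have B': "B \<in> sets (V {m..<n})" using B by auto
  show ?thesis
    using ind A' B' unfolding indep_var_eq indep_sets2_eq V_def sets_vimage_algebra space_P by blast
qed

text \<open>The events over finite sets of times are pi-systems generating the past and the future,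
  so independence extends from them.\<close>

lemma indep_past_future:
  assumes s: "0 \<le> s" and A: "A \<in> sets (canonical_filtration s)" and B: "B \<in> sets (generated_by (increment s) {s..})"
  shows "prob (A \<inter> B) = prob A * prob B"
proof -
  let ?E = "\<lambda>X T. \<Union>F\<in>{F. finite F \<and> F \<subseteq> T}. sets (generated_by X F)"
  have "indep_set (?E canonical_process {0..s}) (?E (increment s) {s..})"
    unfolding indep_sets2_eq
  proof (intro conjI ballI)
    show "?E canonical_process {0..s} \<subseteq> events"
      using canonical_filtration_events[of s] generated_by_mono[of _ "{0..s}" canonical_process]
      unfolding canonical_filtration_eq by blast
    show "?E (increment s) {s..} \<subseteq> events"
      using increment_events[OF s] generated_by_mono[of _ "{s..}" "increment s"] by blast
  next
    fix A B :: "(real \<Rightarrow> real^'d) set" assume "A \<in> ?E canonical_process {0..s}" "B \<in> ?E (increment s) {s..}"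
    then obtain F G where "finite F" "F \<subseteq> {0..s}" "A \<in> sets (generated_by canonical_process F)"
      "finite G" "G \<subseteq> {s..}" "B \<in> sets (generated_by (increment s) G)" by auto
    then show "prob (A \<inter> B) = prob A * prob B" by (intro indep_finite_past_future[OF s])
  qed
  then have "indep_set (sigma_sets (space P) (?E canonical_process {0..s})) (sigma_sets (space P) (?E (increment s) {s..}))"
    by (intro indep_set_sigma_sets Int_stable_Union_generated_by)
  moreover have "A \<in> sigma_sets (space P) (?E canonical_process {0..s})"
    using A generated_by_subset_finite unfolding canonical_filtration_eq space_P by (rule subsetD[rotated])
  moreover have "B \<in> sigma_sets (space P) (?E (increment s) {s..})"
    using B generated_by_subset_finite unfolding space_P by (rule subsetD[rotated])
  ultimately show ?thesis unfolding indep_sets2_eq by (elim conjE) (drule (1) bspec, drule (1) bspec, assumption)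
qed

end

section \<open>Right-continuity of the augmented filtration\<close>

context wiener
begin

text \<open>The sets over which \<open>Z\<close> integrates to 0 form a Dynkin system. The step to
  complements uses that the whole space belongs to \<open>E\<close>, so that the total integral
  vanishes.\<close>

lemma set_integral_zero_generator:
  fixes Z :: "(real \<Rightarrow> real^'d) \<Rightarrow> real"
  assumes Z: "integrable P Z" and E: "Int_stable E" "E \<subseteq> events" "path_space \<in> E"
    and zero: "\<And>D. D \<in> E \<Longrightarrow> (LINT \<omega>:D|P. Z \<omega>) = 0"
    and D: "D \<in> sigma_sets path_space E"
  shows "(LINT \<omega>:D|P. Z \<omega>) = 0"
proof -
  have sub: "sigma_sets path_space E \<subseteq> events"
    unfolding space_P[symmetric] using E(2) by (rule sets.sigma_sets_subset)
  have int: "set_integrable P D Z" if "D \<in> events" for D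
    using that Z unfolding set_integrable_def by (rule integrable_mult_indicator)
  have "E \<subseteq> Pow path_space" using order.trans[OF E(2) sets.space_closed] by simp
  from E(1) this D show ?thesis
  proof (induction rule: sigma_sets_induct_disjoint)
    case (basic A)
    then show ?case by (rule zero)
  next
    case empty
    show ?case by (simp add: set_lebesgue_integral_def)
  next
    case (compl A)
    then have A: "A \<in> events" "A \<subseteq> path_space" using sub sets.sets_into_space[of A P] by auto
    have "(LINT \<omega>:A \<union> (path_space - A)|P. Z \<omega>) = (LINT \<omega>:A|P. Z \<omega>) + (LINT \<omega>:path_space - A|P. Z \<omega>)"
      using A sets.compl_sets[OF A(1)] by (intro set_integral_Un int) auto
    moreover have "A \<union> (path_space - A) = path_space" using A by auto
    ultimately show ?case using compl zero[OF E(3)] by simp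
  next
    case (union A)
    then have A: "A i \<in> events" for i using sub by auto
    have "(LINT \<omega>:(\<Union>i. A i)|P. Z \<omega>) = (\<Sum>i. LINT \<omega>:A i|P. Z \<omega>)"
      using A union(1) by (intro lebesgue_integral_countable_add int) (auto simp: disjoint_family_on_def)
    then show ?case using union by simp
  qed
qed

text \<open>By continuity at \<open>t\<close>, an increment from \<open>t\<close> is a limit of
  increments from slightly later times. This closes the gap between \<open>t\<close> and
  \<open>t + 1/(n+1)\<close> in the germ argument.\<close>

lemma increments_after_subset:
  assumes "0 \<le> t"
  shows "(sets (generated_by (increment t) {t..}) :: (real \<Rightarrow> real^'d) set set) \<subseteq>
    sigma_sets path_space (\<Union>n. sets (generated_by (increment (t + 1 / real (Suc n))) {t + 1 / real (Suc n)..}))"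
proof -
  let ?t = "\<lambda>n. t + 1 / real (Suc n)"
  let ?E = "\<Union>n. sets (generated_by (increment (?t n)) {?t n..}) :: (real \<Rightarrow> real^'d) set set"
  let ?N = "sigma path_space ?E"
  have "?E \<subseteq> Pow path_space" using sets.sets_into_space by fastforce
  then have N: "space ?N = path_space" "sets ?N = sigma_sets path_space ?E"
    by (rule space_measure_of, rule sets_measure_of)
  have t: "?t \<longlonglongrightarrow> t"
    using tendsto_add[OF tendsto_const LIMSEQ_inverse_real_of_nat, of t] by (simp add: inverse_eq_divide)
  have "(sets (generated_by (increment t) {t..}) :: (real \<Rightarrow> real^'d) set set) \<subseteq> sets ?N"
  proof (rule generated_by_least[OF N(1)])
    fix r assume r: "r \<in> {t..}"
    show "increment t r \<in> borel_measurable ?N"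
    proof (rule borel_measurable_LIMSEQ_metric)
      fix n
      \<comment> \<open>The maximum keeps the end time in the index range: it equals
        \<open>r\<close> eventually if \<open>r > t\<close>, and for \<open>r = t\<close> all these
        increments are 0.\<close>
      have "increment (?t n) (max r (?t n)) \<in> borel_measurable (generated_by (increment (?t n)) {?t n..})"
        by (rule measurable_generated_by) auto
      moreover have "subalgebra ?N (generated_by (increment (?t n)) {?t n..})"
        unfolding subalgebra_def N by (auto intro!: sigma_sets.Basic)
      ultimately show "increment (?t n) (max r (?t n)) \<in> borel_measurable ?N"
        by (rule measurable_from_subalg[rotated])
    next
      fix \<omega> assume "\<omega> \<in> space ?N"
      then have "\<omega> \<in> path_space" using N by simp
      moreover have "(\<lambda>n. max r (?t n)) \<longlonglongrightarrow> r"
        using tendsto_max[OF tendsto_const t, of r] r by simp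
      ultimately show "(\<lambda>n. increment (?t n) (max r (?t n)) \<omega>) \<longlonglongrightarrow> increment t r \<omega>"
        using t r assms by (intro tendsto_diff path_space_continuous) auto
    qed
  qed
  then show ?thesis unfolding N .
qed

text \<open>Up to a null set, \<open>A\<close> belongs to the past of \<open>t + 1/(n+1)\<close> for
  every n, hence is independent of the increments after each of these times. The sigma-algebras of
  these increments grow with n, so their union is a pi-system, and it generates the increments after
  \<open>t\<close>. The event \<open>B\<close> is carried along because the germ argument tests
  against products of past and future.\<close>

lemma indep_past_future_approx:
  assumes t: "0 \<le> t" and A: "A \<in> events"
    and approx: "\<And>n. \<exists>A'\<in>sets (canonical_filtration (t + 1 / real (Suc n))). AE \<omega> in P. \<omega> \<in> A \<longleftrightarrow> \<omega> \<in> A'"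
    and B: "B \<in> sets (canonical_filtration t)" and C: "C \<in> sets (generated_by (increment t) {t..})"
  shows "prob (A \<inter> B \<inter> C) = prob (A \<inter> B) * prob C"
proof -
  let ?t = "\<lambda>n. t + 1 / real (Suc n)"
  let ?H = "\<lambda>s. sets (generated_by (increment s) {s..}) :: (real \<Rightarrow> real^'d) set set"
  let ?E = "\<Union>n. ?H (?t n)"
  \<comment> \<open>An increment from the later time is a difference of two increments from the
    earlier one.\<close>
  have H: "?H s' \<subseteq> ?H s" if "s \<le> s'" for s s'
  proof (rule generated_by_least)
    fix r assume r: "r \<in> {s'..}"
    have "(\<lambda>\<omega>. increment s r \<omega> - increment s s' \<omega>) \<in> borel_measurable (generated_by (increment s) {s..})"
      using that r by (intro borel_measurable_diff measurable_generated_by) auto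
    then show "increment s' r \<in> borel_measurable (generated_by (increment s) {s..})" by simp
  qed simp
  have "indep_set {A \<inter> B} ?E"
    unfolding indep_sets2_eq
  proof (intro conjI ballI)
    have B': "B \<in> events" using B canonical_filtration_events by blast
    then show "{A \<inter> B} \<subseteq> events" using A by auto
    show "?E \<subseteq> events" using increment_events t by (intro UN_least) simp
    fix D C assume D: "D \<in> {A \<inter> B}" and "C \<in> ?E"
    then obtain n where C: "C \<in> ?H (?t n)" by auto
    have "0 \<le> ?t n" using t by simp
    then have C': "C \<in> events" using increment_events C by blast
    obtain A' where A': "A' \<in> sets (canonical_filtration (?t n))" "AE \<omega> in P. \<omega> \<in> A \<longleftrightarrow> \<omega> \<in> A'"
      using approx by blast
    have A'': "A' \<in> events" using A' canonical_filtration_events by blast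
    have "B \<in> sets (canonical_filtration (?t n))"
      using B generated_by_mono[of "{0..t}" "{0..?t n}" canonical_process]
      unfolding canonical_filtration_eq by auto
    then have "A' \<inter> B \<in> sets (canonical_filtration (?t n))" using A' by auto
    from indep_past_future[OF \<open>0 \<le> ?t n\<close> this C]
    have "prob (A' \<inter> B \<inter> C) = prob (A' \<inter> B) * prob C" .
    moreover have "prob (A' \<inter> B \<inter> C) = prob (A \<inter> B \<inter> C)" "prob (A' \<inter> B) = prob (A \<inter> B)"
      using A'(2) A A'' B' C' by (auto intro!: finite_measure_eq_AE)
    ultimately show "prob (D \<inter> C) = prob D * prob C" using D by simp
  qed
  moreover have "Int_stable {A \<inter> B}" by (simp add: Int_stable_def)
  moreover have "Int_stable ?E"
  proof (rule Int_stableI, clarify)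
    fix C D m n assume C: "C \<in> ?H (?t m)" and D: "D \<in> ?H (?t n)"
    have "1 / real (Suc (max m n)) \<le> 1 / real (Suc m)" "1 / real (Suc (max m n)) \<le> 1 / real (Suc n)"
      by (intro divide_left_mono; simp)+
    then have "C \<in> ?H (?t (max m n))" "D \<in> ?H (?t (max m n))"
      using C D H[of "?t (max m n)" "?t m"] H[of "?t (max m n)" "?t n"] by auto
    then show "C \<inter> D \<in> ?E" by blast
  qed
  ultimately have "indep_set (sigma_sets (space P) {A \<inter> B}) (sigma_sets (space P) ?E)"
    by (rule indep_set_sigma_sets)
  moreover have "A \<inter> B \<in> sigma_sets (space P) {A \<inter> B}" by auto
  moreover have "C \<in> sigma_sets (space P) ?E"
    using increments_after_subset[OF t] C by auto
  ultimately show ?thesis unfolding indep_sets2_eq by (elim conjE) (drule (1) bspec, drule (1) bspec, assumption)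
qed

text \<open>The germ argument: conditionally on the past up to \<open>t\<close>, an event immediately after \<open>t\<close> is
  independent of the increments after \<open>t\<close>, hence of everything.\<close>

lemma canonical_filtration_right_continuous:
  assumes t: "0 \<le> t" and A: "A \<in> sets canonical_sigma_inf"
    and approx: "\<And>n. \<exists>A'\<in>sets (canonical_filtration (t + 1 / real (Suc n))). AE \<omega> in P. \<omega> \<in> A \<longleftrightarrow> \<omega> \<in> A'"
  shows "\<exists>B\<in>sets (canonical_filtration t). AE \<omega> in P. \<omega> \<in> A \<longleftrightarrow> \<omega> \<in> B"
proof -
  let ?F = "canonical_filtration t :: (real \<Rightarrow> real^'d) measure"
  let ?H = "generated_by (increment t) {t..} :: (real \<Rightarrow> real^'d) measure"
  have A' [measurable]: "A \<in> events" using A canonical_sigma_inf_events by blast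
  have subalg: "subalgebra P ?F"
    using canonical_filtration_events by (simp add: subalgebra_def canonical_filtration_eq)
  interpret F: finite_measure_subalgebra P ?F
    by unfold_locales (rule subalg)
  interpret F: sigma_finite_subalgebra P ?F
    by (rule finite_measure_subalgebra_is_sigma_finite) unfold_locales
  define Y where "Y = real_cond_exp P ?F (indicat_real A)"
  have intA: "integrable P (indicat_real A)" by (intro integrable_real_indicator) (simp_all add: less_top[symmetric])
  have Y: "integrable P Y" "Y \<in> borel_measurable ?F" "Y \<in> borel_measurable P"
    unfolding Y_def using intA by auto
  define E where "E = {B \<inter> C | B C. B \<in> sets ?F \<and> C \<in> sets ?H}"
  have FE: "sets ?F \<subseteq> events" and HE: "sets ?H \<subseteq> events"
    using canonical_filtration_events increment_events[OF t] by auto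
  have psF: "path_space \<in> sets ?F" and psH: "path_space \<in> sets ?H"
    using sets.top[of ?F] sets.top[of ?H] by (simp_all add: canonical_filtration_eq)
  \<comment> \<open>Once \<open>Z\<close> vanishes almost everywhere, \<open>A\<close> coincides up
    to a null set with the event \<open>Y = 1\<close>, which belongs to the past of
    \<open>t\<close>.\<close>
  define Z where "Z \<omega> = indicat_real A \<omega> - Y \<omega>" for \<omega>
  have Z: "integrable P Z" unfolding Z_def using intA Y by auto
  \<comment> \<open>Over \<open>B \<inter> C\<close> both terms of \<open>Z\<close> integrate to
    \<open>prob (A \<inter> B) * prob C\<close>. For the indicator this is the preceding
    independence. For \<open>Y\<close>, the product of \<open>Y\<close> with the indicator of
    \<open>B\<close> is measurable for the past, hence independent of \<open>C\<close>, and
    \<open>Y\<close> has the same integral over \<open>B\<close> as the indicator of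
    \<open>A\<close>.\<close>
  have zero: "(LINT \<omega>:D|P. Z \<omega>) = 0" if "D \<in> E" for D
  proof -
    obtain B C where BC: "B \<in> sets ?F" "C \<in> sets ?H" "D = B \<inter> C"
      using \<open>D \<in> E\<close> by (auto simp: E_def)
    have [measurable]: "B \<in> events" "C \<in> events" using BC FE HE by auto
    have "A \<subseteq> path_space" "C \<subseteq> path_space"
      using sets.sets_into_space[OF A] sets.sets_into_space[OF BC(2)] by simp_all
    then have [simp]: "A \<inter> B \<inter> path_space = A \<inter> B" "A \<inter> B \<inter> C \<inter> path_space = A \<inter> B \<inter> C"
      "C \<inter> path_space = C" by auto
    let ?X = "\<lambda>\<omega>. indicat_real B \<omega> * Y \<omega>"
    have X: "?X \<in> borel_measurable ?F" using Y(2) BC by simp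
    have "indep_var borel ?X borel (indicat_real C)"
      unfolding indep_var_eq indep_sets2_eq
    proof (intro conjI ballI)
      let ?SX = "sigma_sets (space P) {?X -` A \<inter> space P |A. A \<in> sets borel}"
      let ?SC = "sigma_sets (space P) {indicat_real C -` A \<inter> space P |A. A \<in> sets borel}"
      show "random_variable borel ?X" "random_variable borel (indicat_real C)"
        using Y by simp_all
      have "space ?F = space P" "space ?H = space P" by (simp_all add: canonical_filtration_eq)
      have SX: "?SX \<subseteq> sets ?F"
        unfolding \<open>space ?F = space P\<close>[symmetric] using measurable_sets[OF X]
        by (intro sets.sigma_sets_subset) auto
      have "indicat_real C \<in> borel_measurable ?H" using BC by simp
      then have SC: "?SC \<subseteq> sets ?H"
        unfolding \<open>space ?H = space P\<close>[symmetric] using measurable_sets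
        by (intro sets.sigma_sets_subset) blast
      show "?SX \<subseteq> events" "?SC \<subseteq> events" using SX SC FE HE by auto
      show "prob (a \<inter> b) = prob a * prob b" if "a \<in> ?SX" "b \<in> ?SC" for a b
        using that SX SC by (intro indep_past_future[OF t]) auto
    qed
    moreover have "integrable P ?X" using Y by (intro integrable_mult_indicator[where 'b = real, simplified]) auto
    moreover have "integrable P (indicat_real C)" by (intro integrable_real_indicator) (simp_all add: less_top[symmetric])
    ultimately have "(\<integral>\<omega>. ?X \<omega> * indicat_real C \<omega> \<partial>P) = (\<integral>\<omega>. ?X \<omega> \<partial>P) * (\<integral>\<omega>. indicat_real C \<omega> \<partial>P)"
      by (rule indep_var_lebesgue_integral)
    moreover have "(\<integral>\<omega>. ?X \<omega> \<partial>P) = prob (A \<inter> B)"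
    proof -
      have "(LINT \<omega>:B|P. Y \<omega>) = (LINT \<omega>:B|P. indicat_real A \<omega>)"
        unfolding Y_def by (rule F.real_cond_exp_intA[OF intA BC(1), symmetric])
      also have "\<dots> = (\<integral>\<omega>. indicat_real (A \<inter> B) \<omega> \<partial>P)"
        unfolding set_lebesgue_integral_def by (intro Bochner_Integration.integral_cong) (auto simp: indicator_def)
      finally show ?thesis by (simp add: set_lebesgue_integral_def)
    qed
    moreover have "(LINT \<omega>:D|P. Y \<omega>) = (\<integral>\<omega>. ?X \<omega> * indicat_real C \<omega> \<partial>P)"
      unfolding set_lebesgue_integral_def BC(3) by (intro Bochner_Integration.integral_cong) (auto simp: indicator_def)
    moreover have "(LINT \<omega>:D|P. indicat_real A \<omega>) = prob (A \<inter> B \<inter> C)"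
    proof -
      have "(LINT \<omega>:D|P. indicat_real A \<omega>) = (\<integral>\<omega>. indicat_real (A \<inter> B \<inter> C) \<omega> \<partial>P)"
        unfolding set_lebesgue_integral_def BC(3) by (intro Bochner_Integration.integral_cong) (auto simp: indicator_def)
      then show ?thesis by simp
    qed
    moreover have "prob (A \<inter> B \<inter> C) = prob (A \<inter> B) * prob C"
      using indep_past_future_approx[OF t A' approx BC(1,2)] .
    moreover have "(LINT \<omega>:D|P. Z \<omega>) = (LINT \<omega>:D|P. indicat_real A \<omega>) - (LINT \<omega>:D|P. Y \<omega>)"
      unfolding Z_def
    proof (rule set_integral_diff)
      have D: "D \<in> events" using BC by simp
      show "set_integrable P D (indicat_real A)" "set_integrable P D Y"
        unfolding set_integrable_def
        by (rule integrable_mult_indicator[OF D intA], rule integrable_mult_indicator[OF D Y(1)])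
    qed
    ultimately show ?thesis by simp
  qed
  \<comment> \<open>Past and later increments generate everything, since a value after
    \<open>t\<close> is the value at \<open>t\<close> plus an increment.\<close>
  have inf: "sets canonical_sigma_inf \<subseteq> sigma_sets path_space E"
  proof -
    have "E \<subseteq> Pow path_space" using FE sets.sets_into_space unfolding E_def by fastforce
    then have N: "space (sigma path_space E) = path_space" "sets (sigma path_space E) = sigma_sets path_space E"
      by (rule space_measure_of, rule sets_measure_of)
    have F: "sets ?F \<subseteq> E"
    proof
      fix B assume B: "B \<in> sets ?F"
      then have "B = B \<inter> path_space" using sets.sets_into_space[OF B] by (auto simp: canonical_filtration_eq)
      then show "B \<in> E" unfolding E_def using B psH by blast
    qed
    have H: "sets ?H \<subseteq> E"
    proof
      fix C assume C: "C \<in> sets ?H"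
      then have "C = path_space \<inter> C" using sets.sets_into_space[OF C] by auto
      then show "C \<in> E" unfolding E_def using C psF by blast
    qed
    have subF: "subalgebra (sigma path_space E) ?F"
      using F N by (auto simp: subalgebra_def canonical_filtration_eq)
    have subH: "subalgebra (sigma path_space E) ?H"
      using H N by (auto simp: subalgebra_def)
    have "canonical_process r \<in> borel_measurable (sigma path_space E)" if "0 \<le> r" for r
    proof (cases "r \<le> t")
      case True
      with that have "canonical_process r \<in> borel_measurable ?F"
        unfolding canonical_filtration_eq by (intro measurable_generated_by) auto
      then show ?thesis by (rule measurable_from_subalg[OF subF])
    next
      case False
      have "canonical_process t \<in> borel_measurable ?F"
        unfolding canonical_filtration_eq using t by (intro measurable_generated_by) auto
      moreover have "increment t r \<in> borel_measurable ?H"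
        using False by (intro measurable_generated_by) auto
      ultimately have "(\<lambda>\<omega>. increment t r \<omega> + \<omega> t) \<in> borel_measurable (sigma path_space E)"
        by (intro borel_measurable_add measurable_from_subalg[OF subF] measurable_from_subalg[OF subH])
      then show ?thesis by simp
    qed
    then have "sets canonical_sigma_inf \<subseteq> sets (sigma path_space E)"
      unfolding sets_canonical_sigma_inf using N by (intro generated_by_least) auto
    then show ?thesis using N by simp
  qed
  have Z0: "(LINT \<omega>:D|P. Z \<omega>) = 0" if "D \<in> sets canonical_sigma_inf" for D
  proof (rule set_integral_zero_generator[OF Z _ _ _ zero])
    show "Int_stable E"
      unfolding Int_stable_def E_def
    proof clarify
      fix B C B' C' assume "B \<in> sets ?F" "C \<in> sets ?H" "B' \<in> sets ?F" "C' \<in> sets ?H"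
      then show "\<exists>B'' C''. B \<inter> C \<inter> (B' \<inter> C') = B'' \<inter> C'' \<and> B'' \<in> sets ?F \<and> C'' \<in> sets ?H"
        by (intro exI[of _ "B \<inter> B'"] exI[of _ "C \<inter> C'"]) auto
    qed
    show "E \<subseteq> events" using FE HE by (auto simp: E_def)
    show "path_space \<in> E" using psF psH by (auto simp: E_def)
  qed (use that subsetD[OF inf] in blast)+
  \<comment> \<open>The integrals of \<open>Z\<close> are known to vanish only over sets of
    \<open>canonical_sigma_inf\<close>. As \<open>Z\<close> is measurable for it, restricting the
    measure to this sigma-algebra loses nothing.\<close>
  have "AE \<omega> in restr_to_subalg P canonical_sigma_inf. Z \<omega> = 0"
  proof -
    have sub: "subalgebra P canonical_sigma_inf" using canonical_sigma_inf_events by (simp add: subalgebra_def)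
    interpret R: finite_measure "restr_to_subalg P canonical_sigma_inf"
      by (rule finite_measure_restr_to_subalg[OF sub]) unfold_locales
    have "Y \<in> borel_measurable canonical_sigma_inf"
      using Y(2) by (rule measurable_from_subalg[rotated])
        (use canonical_filtration_subset_inf in \<open>auto simp: subalgebra_def canonical_filtration_eq\<close>)
    then have Zm: "(\<lambda>\<omega>. indicat_real D \<omega> *\<^sub>R Z \<omega>) \<in> borel_measurable canonical_sigma_inf"
      if "D \<in> sets canonical_sigma_inf" for D
      unfolding Z_def using A that by simp
    have "Z \<in> borel_measurable canonical_sigma_inf"
      using \<open>Y \<in> borel_measurable canonical_sigma_inf\<close> A unfolding Z_def by simp
    then have "integrable (restr_to_subalg P canonical_sigma_inf) Z"
      using integrable_in_subalg[OF sub _ Z] by blast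
    then show ?thesis
    proof (rule R.density_zero)
      fix D assume "D \<in> sets (restr_to_subalg P canonical_sigma_inf)"
      then have D: "D \<in> sets canonical_sigma_inf" by (simp add: sets_restr_to_subalg[OF sub])
      then show "set_lebesgue_integral (restr_to_subalg P canonical_sigma_inf) D Z = 0"
        using Z0[OF D] integral_subalgebra2[OF sub Zm[OF D]] unfolding set_lebesgue_integral_def by simp
    qed
  qed
  then have "AE \<omega> in P. Z \<omega> = 0"
    by (rule AE_restr_to_subalg[rotated]) (use canonical_sigma_inf_events in \<open>simp add: subalgebra_def\<close>)
  then have "AE \<omega> in P. \<omega> \<in> A \<longleftrightarrow> \<omega> \<in> {\<omega> \<in> space ?F. Y \<omega> = 1}"
    using AE_space
  proof eventually_elim
    case (elim \<omega>)
    then show ?case by (auto simp: Z_def indicator_def canonical_filtration_eq split: if_splits)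
  qed
  moreover have "{\<omega> \<in> space ?F. Y \<omega> = 1} \<in> sets ?F" using Y(2) by simp
  ultimately show ?thesis by blast
qed

section \<open>The augmented sigma-algebras modulo null sets\<close>

definition null_parts :: "(real \<Rightarrow> real^'d) set set" where
  "null_parts = {N. \<exists>Z \<in> sets canonical_sigma_inf. emeasure P Z = 0 \<and> N \<subseteq> Z}"

lemma null_parts_subset: "null_parts \<subseteq> Pow path_space"
  using sets.sets_into_space[of _ canonical_sigma_inf] by (auto simp: null_parts_def)

lemma generators_augmented_subset: "sets (canonical_filtration s) \<union> null_parts \<subseteq> Pow path_space"
  using null_parts_subset sets.sets_into_space[of _ "canonical_filtration s"]
  by (auto simp: canonical_filtration_eq)

lemma space_augmented_filtration [simp]: "space (augmented_filtration P s) = path_space"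
  unfolding augmented_filtration_def null_parts_def[symmetric]
  by (rule space_measure_of[OF generators_augmented_subset])

lemma sets_augmented_filtration:
  "sets (augmented_filtration P s) = sigma_sets path_space (sets (canonical_filtration s) \<union> null_parts)"
  unfolding augmented_filtration_def null_parts_def[symmetric]
  by (rule sets_measure_of[OF generators_augmented_subset])

text \<open>The sets that agree with a member of \<open>canonical_filtration s\<close> up to a null
  part form a sigma-algebra containing both families of generators. Questions about the augmented
  filtration thus reduce to the canonical one.\<close>

lemma augmented_filtration_iff:
  "A \<in> sets (augmented_filtration P s) \<longleftrightarrow>
    A \<subseteq> path_space \<and> (\<exists>B\<in>sets (canonical_filtration s). sym_diff A B \<in> null_parts)"
proof
  assume "A \<in> sets (augmented_filtration P s)"
  then have "A \<in> sigma_sets path_space (sets (canonical_filtration s) \<union> null_parts)"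
    by (simp add: sets_augmented_filtration)
  then show "A \<subseteq> path_space \<and> (\<exists>B\<in>sets (canonical_filtration s). sym_diff A B \<in> null_parts)"
  proof (induction rule: sigma_sets.induct)
    case (Basic A)
    then show ?case
    proof
      assume "A \<in> sets (canonical_filtration s)"
      moreover have "sym_diff A A \<in> null_parts" by (auto simp: null_parts_def intro!: bexI[of _ "{}"])
      moreover have "A \<subseteq> path_space"
        using sets.sets_into_space[OF \<open>A \<in> sets (canonical_filtration s)\<close>] by (simp add: canonical_filtration_eq)
      ultimately show ?thesis by blast
    next
      assume "A \<in> null_parts"
      then show ?thesis using null_parts_subset by (auto intro!: bexI[of _ "{}"])
    qed
  next
    case Empty
    then show ?case by (auto simp: null_parts_def intro!: bexI[of _ "{}"])
  next
    case (Compl A)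
    then obtain B where A: "A \<subseteq> path_space" and B: "B \<in> sets (canonical_filtration s)" "sym_diff A B \<in> null_parts"
      by blast
    have "B \<subseteq> path_space" using sets.sets_into_space[OF B(1)] by (simp add: canonical_filtration_eq)
    then have "sym_diff (path_space - A) (path_space - B) = sym_diff A B" using A by auto
    moreover have "path_space - B \<in> sets (canonical_filtration s)"
      using sets.compl_sets[OF B(1)] by (simp add: canonical_filtration_eq)
    ultimately show ?case using B by (intro conjI bexI[of _ "path_space - B"]) auto
  next
    case (Union A)
    then obtain B where B: "\<And>i. B i \<in> sets (canonical_filtration s)" "\<And>i. sym_diff (A i) (B i) \<in> null_parts"
      by metis
    then obtain Z where Z: "\<And>i. Z i \<in> sets canonical_sigma_inf" "\<And>i. emeasure P (Z i) = 0"
      "\<And>i. sym_diff (A i) (B i) \<subseteq> Z i"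
      unfolding null_parts_def mem_Collect_eq by metis
    have "Z i \<in> null_sets P" for i
      using Z(2) subsetD[OF canonical_sigma_inf_events Z(1)] by (rule null_setsI)
    then have "(\<Union>i. Z i) \<in> null_sets P" by (rule null_sets_UN)
    moreover have "sym_diff (\<Union>i. A i) (\<Union>i. B i) \<subseteq> (\<Union>i. Z i)" using Z(3) by blast
    ultimately have "sym_diff (\<Union>i. A i) (\<Union>i. B i) \<in> null_parts"
      using Z(1) unfolding null_parts_def by (auto intro!: bexI[of _ "\<Union>i. Z i"])
    then show ?case using Union B(1) by (intro conjI UN_least bexI[of _ "\<Union>i. B i"]) auto
  qed
next
  assume "A \<subseteq> path_space \<and> (\<exists>B\<in>sets (canonical_filtration s). sym_diff A B \<in> null_parts)"
  then obtain B where B: "B \<in> sets (canonical_filtration s)" "sym_diff A B \<in> null_parts" by blast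
  have sub: "sets (canonical_filtration s) \<union> null_parts \<subseteq> sets (augmented_filtration P s)"
    unfolding sets_augmented_filtration by auto
  have "A - B \<in> null_parts" "B - A \<in> null_parts" using B(2) by (auto simp: null_parts_def)
  then have "A - B \<in> sets (augmented_filtration P s)" "B - A \<in> sets (augmented_filtration P s)"
    "B \<in> sets (augmented_filtration P s)"
    using sub B(1) by blast+
  then have "(B - (B - A)) \<union> (A - B) \<in> sets (augmented_filtration P s)"
    by (metis sets.Diff sets.Un)
  moreover have "(B - (B - A)) \<union> (A - B) = A" by auto
  ultimately show "A \<in> sets (augmented_filtration P s)" by simp
qed

lemma null_parts_iff_AE:
  assumes "A \<in> sets canonical_sigma_inf" "B \<in> sets canonical_sigma_inf"
  shows "sym_diff A B \<in> null_parts \<longleftrightarrow> (AE \<omega> in P. \<omega> \<in> A \<longleftrightarrow> \<omega> \<in> B)"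
proof -
  have D: "sym_diff A B \<in> sets canonical_sigma_inf" using assms by auto
  have "sym_diff A B \<in> null_parts \<longleftrightarrow> emeasure P (sym_diff A B) = 0"
  proof
    assume "sym_diff A B \<in> null_parts"
    then obtain Z where "Z \<in> sets canonical_sigma_inf" "emeasure P Z = 0" "sym_diff A B \<subseteq> Z"
      unfolding null_parts_def by blast
    then show "emeasure P (sym_diff A B) = 0"
      using emeasure_mono[of "sym_diff A B" Z P] canonical_sigma_inf_events by auto
  qed (use D in \<open>auto simp: null_parts_def\<close>)
  also have "\<dots> \<longleftrightarrow> (AE \<omega> in P. \<omega> \<in> A \<longleftrightarrow> \<omega> \<in> B)"
  proof (rule AE_iff_measurable[symmetric])
    show "sym_diff A B \<in> events" using D canonical_sigma_inf_events by blast
    show "{\<omega> \<in> space P. (\<omega> \<in> A) \<noteq> (\<omega> \<in> B)} = sym_diff A B"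
      using assms sets.sets_into_space[of A canonical_sigma_inf] sets.sets_into_space[of B canonical_sigma_inf] by auto
  qed
  finally show ?thesis .
qed

lemma null_parts_Un:
  assumes "M \<in> null_parts" "N \<in> null_parts" "L \<subseteq> M \<union> N"
  shows "L \<in> null_parts"
proof -
  obtain X Y where X: "X \<in> sets canonical_sigma_inf" "emeasure P X = 0" "M \<subseteq> X"
    and Y: "Y \<in> sets canonical_sigma_inf" "emeasure P Y = 0" "N \<subseteq> Y"
    using assms unfolding null_parts_def by blast
  have "X \<in> null_sets P" "Y \<in> null_sets P" using X Y canonical_sigma_inf_events by (auto intro!: null_setsI)
  then have "X \<union> Y \<in> null_sets P" by (rule null_sets.Un)
  then show ?thesis
    using X Y assms(3) unfolding null_parts_def by (auto intro!: bexI[of _ "X \<union> Y"])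
qed

text \<open>The set \<open>A\<close> itself may lie outside \<open>canonical_sigma_inf\<close>, so
  \<open>B 0\<close> takes its place: it differs from each \<open>B n\<close> by a null part, hence
  satisfies the hypothesis of the germ argument.\<close>

lemma augmented_filtration_right_continuous:
  assumes t: "0 \<le> t" and A: "\<And>n. A \<in> sets (augmented_filtration P (t + 1 / real (Suc n)))"
  shows "A \<in> sets (augmented_filtration P t)"
proof -
  obtain B where B: "\<And>n. B n \<in> sets (canonical_filtration (t + 1 / real (Suc n)))"
    "\<And>n. sym_diff A (B n) \<in> null_parts"
    using A unfolding augmented_filtration_iff by metis
  have inf: "B n \<in> sets canonical_sigma_inf" for n
    using B(1) canonical_filtration_subset_inf by blast
  have "\<exists>C\<in>sets (canonical_filtration t). AE \<omega> in P. \<omega> \<in> B 0 \<longleftrightarrow> \<omega> \<in> C"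
  proof (rule canonical_filtration_right_continuous[OF t inf])
    fix n
    have "sym_diff (B 0) (B n) \<in> null_parts"
      using B(2)[of 0] B(2)[of n] by (rule null_parts_Un) auto
    then show "\<exists>C\<in>sets (canonical_filtration (t + 1 / real (Suc n))). AE \<omega> in P. \<omega> \<in> B 0 \<longleftrightarrow> \<omega> \<in> C"
      using B(1) null_parts_iff_AE[OF inf inf] by blast
  qed
  then obtain C where C: "C \<in> sets (canonical_filtration t)" "AE \<omega> in P. \<omega> \<in> B 0 \<longleftrightarrow> \<omega> \<in> C" by blast
  then have "sym_diff (B 0) C \<in> null_parts"
    using null_parts_iff_AE[OF inf] canonical_filtration_subset_inf by blast
  with B(2)[of 0] have "sym_diff A C \<in> null_parts"
    by (rule null_parts_Un) auto
  moreover have "A \<subseteq> path_space" using A[of 0] unfolding augmented_filtration_iff by (rule conjunct1)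
  ultimately show ?thesis
    unfolding augmented_filtration_iff using C(1) by blast
qed

end

section \<open>Stopping times\<close>

lemma ext_arctan_measurable [measurable]: "ext_arctan \<in> borel_measurable borel"
  unfolding ext_arctan_def by measurable

lemma ext_arctan_strict_mono: "s < t \<Longrightarrow> ext_arctan s < ext_arctan t"
proof (cases s; cases t)
  fix a b assume "s < t" "s = ennreal a" "0 \<le> a" "t = ennreal b" "0 \<le> b"
  then show ?thesis by (simp add: ext_arctan_def ennreal_less_iff arctan_less_iff)
next
  fix a assume "s = ennreal a" "0 \<le> a" "t = top"
  then show ?thesis using arctan_ubound[of a] by (simp add: ext_arctan_def)
qed auto

lemma ext_arctan_less_iff: "ext_arctan s < ext_arctan t \<longleftrightarrow> s < t"
  by (metis ext_arctan_strict_mono less_asym less_irrefl linorder_neqE)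

lemma ext_arctan_inject: "ext_arctan s = ext_arctan t \<longleftrightarrow> s = t"
  by (metis ext_arctan_strict_mono less_irrefl linorder_neqE)

lemma ext_arctan_range: "ext_arctan t \<in> {0..pi / 2}"
  using arctan_ubound[of "enn2real t"] by (auto simp: ext_arctan_def less_imp_le)

lemma ext_arctan_surj:
  assumes "L \<in> {0..pi / 2}"
  obtains t where "ext_arctan t = L"
proof (cases "L = pi / 2")
  case True
  then show thesis using that[of top] by (simp add: ext_arctan_def)
next
  case False
  with assms have "0 \<le> L" "L < pi / 2" by auto
  moreover from this have "0 \<le> tan L" using tan_pos_pi2_le by blast
  ultimately show thesis using that[of "ennreal (tan L)"] by (simp add: ext_arctan_def arctan_tan)
qed

text \<open>\<open>ext_arctan\<close> is an order isomorphism onto the closed interval from 0 to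
  pi/2. The limit of the images therefore has a preimage, and convergence carries over through the
  order topology.\<close>

lemma convergent_if_Cauchy_ext_arctan:
  assumes "Cauchy (\<lambda>i. ext_arctan (u i))"
  obtains x where "u \<longlonglongrightarrow> x" "(\<lambda>i. ext_arctan (u i)) \<longlonglongrightarrow> ext_arctan x"
proof -
  obtain L where L: "(\<lambda>i. ext_arctan (u i)) \<longlonglongrightarrow> L"
    using Cauchy_convergent[OF assms] by (auto simp: convergent_def)
  have "L \<in> {0..pi / 2}"
    by (rule closed_sequentially[OF _ _ L]) (use ext_arctan_range in auto)
  then obtain x where x: "ext_arctan x = L" by (rule ext_arctan_surj)
  have "u \<longlonglongrightarrow> x"
  proof (rule order_tendstoI)
    fix a assume "a < x"
    then have "ext_arctan a < L" using ext_arctan_strict_mono x by blast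
    from order_tendstoD(1)[OF L this] show "\<forall>\<^sub>F i in sequentially. a < u i"
      by (simp add: ext_arctan_less_iff)
  next
    fix a assume "x < a"
    then have "L < ext_arctan a" using ext_arctan_strict_mono x by blast
    from order_tendstoD(2)[OF L this] show "\<forall>\<^sub>F i in sequentially. u i < a"
      by (simp add: ext_arctan_less_iff)
  qed
  with L x show thesis using that by blast
qed

text \<open>The free \<open>n\<close> is the purpose of this form: only large \<open>m\<close>
  matter, so the condition may be confined to \<open>m\<close> at least \<open>n\<close>, where all
  times are at most \<open>t + 1/(n+1)\<close>. Stating this as an implication keeps all quantifiers
  ranging over the natural numbers.\<close>

lemma limsup_le_ennreal_iff:
  fixes u :: "nat \<Rightarrow> ennreal"
  assumes t: "0 \<le> t"
  shows "limsup u \<le> ennreal t \<longleftrightarrow> (\<forall>m. \<exists>N. \<forall>i. n \<le> m \<longrightarrow> u (N + i) \<le> ennreal (t + 1 / real (Suc m)))"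
proof
  assume le: "limsup u \<le> ennreal t"
  show "\<forall>m. \<exists>N. \<forall>i. n \<le> m \<longrightarrow> u (N + i) \<le> ennreal (t + 1 / real (Suc m))"
  proof
    fix m
    have "ennreal t < ennreal (t + 1 / real (Suc m))" using t by (intro ennreal_lessI add_nonneg_pos) simp_all
    with le have "limsup u < ennreal (t + 1 / real (Suc m))" by (rule le_less_trans)
    then have "\<forall>\<^sub>F i in sequentially. u i < ennreal (t + 1 / real (Suc m))" by (rule Limsup_lessD)
    then obtain N where N: "\<And>i. N \<le> i \<Longrightarrow> u i < ennreal (t + 1 / real (Suc m))"
      unfolding eventually_sequentially by blast
    then show "\<exists>N. \<forall>i. n \<le> m \<longrightarrow> u (N + i) \<le> ennreal (t + 1 / real (Suc m))"
      using less_imp_le[OF N[OF le_add1]] by blast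
  qed
next
  assume ev: "\<forall>m. \<exists>N. \<forall>i. n \<le> m \<longrightarrow> u (N + i) \<le> ennreal (t + 1 / real (Suc m))"
  have "(\<lambda>m. t + 1 / real (Suc m)) \<longlonglongrightarrow> t"
    using tendsto_add[OF tendsto_const LIMSEQ_inverse_real_of_nat, of t] by (simp add: inverse_eq_divide)
  then have "(\<lambda>m. ennreal (t + 1 / real (Suc m))) \<longlonglongrightarrow> ennreal t" by (rule tendsto_ennrealI)
  moreover have "limsup u \<le> ennreal (t + 1 / real (Suc m))" if m: "n \<le> m" for m
  proof (rule Limsup_bounded)
    obtain N where N: "\<And>i. u (N + i) \<le> ennreal (t + 1 / real (Suc m))" using ev m by blast
    show "\<forall>\<^sub>F i in sequentially. u i \<le> ennreal (t + 1 / real (Suc m))"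
      using eventually_ge_at_top[of N]
    proof eventually_elim
      case (elim i)
      then show ?case using N[of "i - N"] by simp
    qed
  qed
  ultimately show "limsup u \<le> ennreal t" by (intro LIMSEQ_le_const) auto
qed

section \<open>Extended stopping times and their metric\<close>

context wiener
begin

sublocale comp: prob_space "completion P"
  by (rule prob_space_completion)

lemma canonical_sigma_inf_completion: "sets canonical_sigma_inf \<subseteq> sets (completion P)"
  using canonical_sigma_inf_events by auto

lemma null_parts_null_sets: "null_parts \<subseteq> null_sets (completion P)"
proof
  fix N assume "N \<in> null_parts"
  then obtain Z where "Z \<in> sets canonical_sigma_inf" "emeasure P Z = 0" "N \<subseteq> Z"
    unfolding null_parts_def by blast
  then show "N \<in> null_sets (completion P)"
    unfolding null_sets_completion_iff2 using canonical_sigma_inf_events by (intro bexI[of _ Z] null_setsI) auto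
qed

lemma augmented_filtration_least:
  assumes "space N = path_space" "sets canonical_sigma_inf \<subseteq> sets N" "null_parts \<subseteq> sets N"
  shows "sets (augmented_filtration P s) \<subseteq> sets N"
  unfolding sets_augmented_filtration assms(1)[symmetric]
  using assms(2,3) canonical_filtration_subset_inf by (intro sets.sigma_sets_subset) blast

lemma augmented_filtration_completion: "sets (augmented_filtration P s) \<subseteq> sets (completion P)"
  using null_parts_null_sets canonical_sigma_inf_completion by (intro augmented_filtration_least) auto

lemma augmented_filtration_mono:
  assumes "s \<le> t" shows "sets (augmented_filtration P s) \<subseteq> sets (augmented_filtration P t)"
proof -
  have "sets (canonical_filtration s :: (real \<Rightarrow> real^'d) measure) \<subseteq> sets (canonical_filtration t)"
    unfolding canonical_filtration_eq using assms by (intro generated_by_mono) auto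
  then show ?thesis unfolding sets_augmented_filtration by (intro sigma_sets_subseteq) auto
qed

text \<open>The general \<open>N\<close> serves two cases: the completed sigma-algebra, for the
  integrals, and the approximable sets, for separability.\<close>

lemma borel_measurable_ext_stopping_time:
  assumes N: "space N = path_space" "\<And>t. sets (augmented_filtration P t) \<subseteq> sets N"
    and \<tau>: "\<tau> \<in> ext_stopping_times P"
  shows "\<tau> \<in> borel_measurable N"
proof (rule borel_measurableI_le)
  fix y :: ennreal
  show "{\<omega> \<in> space N. \<tau> \<omega> \<le> y} \<in> sets N"
  proof (cases y)
    case (real t)
    then have "Measurable.pred (augmented_filtration P t) (\<lambda>\<omega>. \<tau> \<omega> \<le> ennreal t)"
      using \<tau> by (simp add: ext_stopping_times_def)
    then have "{\<omega> \<in> path_space. \<tau> \<omega> \<le> y} \<in> sets (augmented_filtration P t)"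
      unfolding pred_def real by simp
    then show ?thesis using N by auto
  next
    case top
    then have "{\<omega> \<in> space N. \<tau> \<omega> \<le> y} = space N" by simp
    then show ?thesis by (metis sets.top)
  qed
qed

lemma ext_stopping_time_completion:
  "\<tau> \<in> ext_stopping_times P \<Longrightarrow> \<tau> \<in> borel_measurable (completion P)"
  using augmented_filtration_completion by (intro borel_measurable_ext_stopping_time) auto

text \<open>For every n the event belongs to the augmented sigma-algebra at
  \<open>t + 1/(n+1)\<close>, and right-continuity moves it to \<open>t\<close>. The upper limit is
  defined on every path, so no exceptional set needs separate treatment.\<close>

lemma limsup_ext_stopping_time:
  assumes \<sigma>: "\<And>n. \<sigma> n \<in> ext_stopping_times P"
  shows "(\<lambda>\<omega>. limsup (\<lambda>n. \<sigma> n \<omega>)) \<in> ext_stopping_times P"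
  unfolding ext_stopping_times_def
proof (intro CollectI allI impI)
  fix t :: real assume t: "0 \<le> t"
  have "{\<omega> \<in> path_space. limsup (\<lambda>n. \<sigma> n \<omega>) \<le> ennreal t} \<in> sets (augmented_filtration P t)"
  proof (rule augmented_filtration_right_continuous[OF t])
    fix n
    let ?N = "augmented_filtration P (t + 1 / real (Suc n))"
    have *: "Measurable.pred ?N (\<lambda>\<omega>. n \<le> m \<longrightarrow> \<sigma> i \<omega> \<le> ennreal (t + 1 / real (Suc m)))" for m i
    proof (cases "n \<le> m")
      case True
      have "0 \<le> t + 1 / real (Suc m)" using t by simp
      then have "Measurable.pred (augmented_filtration P (t + 1 / real (Suc m))) (\<lambda>\<omega>. \<sigma> i \<omega> \<le> ennreal (t + 1 / real (Suc m)))"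
        using \<sigma>[of i] unfolding ext_stopping_times_def by blast
      then have *: "{\<omega> \<in> path_space. \<sigma> i \<omega> \<le> ennreal (t + 1 / real (Suc m))}
          \<in> sets (augmented_filtration P (t + 1 / real (Suc m)))"
        unfolding pred_def by (simp only: space_augmented_filtration)
      have "t + 1 / real (Suc m) \<le> t + 1 / real (Suc n)"
        using True by (intro add_left_mono divide_left_mono) auto
      from subsetD[OF augmented_filtration_mono[OF this] *] show ?thesis
        using True unfolding pred_def by (simp only: space_augmented_filtration simp_thms)
    qed simp
    have "Measurable.pred ?N (\<lambda>\<omega>. \<forall>m. \<exists>N. \<forall>i. n \<le> m \<longrightarrow> \<sigma> (N + i) \<omega> \<le> ennreal (t + 1 / real (Suc m)))"
      by (intro pred_intros_countable *)
    moreover have "limsup (\<lambda>n. \<sigma> n \<omega>) \<le> ennreal t \<longleftrightarrow>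
      (\<forall>m. \<exists>N. \<forall>i. n \<le> m \<longrightarrow> \<sigma> (N + i) \<omega> \<le> ennreal (t + 1 / real (Suc m)))" for \<omega>
      by (rule limsup_le_ennreal_iff[OF t])
    ultimately show "{\<omega> \<in> path_space. limsup (\<lambda>n. \<sigma> n \<omega>) \<le> ennreal t} \<in> sets ?N"
      unfolding pred_def by (simp only: space_augmented_filtration)
  qed
  then show "Measurable.pred (augmented_filtration P t) (\<lambda>\<omega>. limsup (\<lambda>n. \<sigma> n \<omega>) \<le> ennreal t)"
    unfolding pred_def by simp
qed

text \<open>Differences of arctangents on [0,\<infinity>] are at most pi/2, hence below 2, and
  truncation at 2 changes nothing.\<close>

lemma time_dist_eq:
  "time_dist P \<tau>1 \<tau>2 = trunc_dist (completion P) 2 (\<lambda>\<omega>. ext_arctan (\<tau>1 \<omega>)) (\<lambda>\<omega>. ext_arctan (\<tau>2 \<omega>))"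
proof -
  have "\<bar>ext_arctan s - ext_arctan t\<bar> \<le> 2" for s t
    using ext_arctan_range[of s] ext_arctan_range[of t] pi_less_4 by auto
  then show ?thesis
    unfolding time_dist_def trunc_dist_def dist_real_def by (simp add: min_absorb2)
qed

text \<open>One countable family serves all times at once: it approximates the generators of
  \<open>canonical_sigma_inf\<close>, and null parts are approximable anyway.\<close>

lemma approximation_augmented:
  obtains \<A> where "countable \<A>" "\<A> \<subseteq> sets (completion P)"
    "sigma_algebra path_space (approximable (completion P) \<A>)"
    "(\<Union>s. sets (augmented_filtration P s)) \<subseteq> approximable (completion P) \<A>"
proof -
  obtain \<C> :: "(real \<Rightarrow> real^'d) set set" where \<C>: "countable \<C>" "\<C> \<subseteq> sets canonical_sigma_inf"
    "sets canonical_sigma_inf \<subseteq> sigma_sets path_space \<C>"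
    by (rule canonical_sigma_inf_countably_generated)
  obtain \<A> where \<A>: "countable \<A>" "\<A> \<subseteq> sets (completion P)"
    "sigma_algebra (space (completion P)) (approximable (completion P) \<A>)"
    "\<C> \<subseteq> approximable (completion P) \<A>" "null_sets (completion P) \<subseteq> approximable (completion P) \<A>"
    using comp.countable_approximation[OF \<C>(1)] \<C>(2) canonical_sigma_inf_completion by blast
  interpret A: sigma_algebra path_space "approximable (completion P) \<A>" using \<A>(3) by simp
  let ?N = "sigma path_space (approximable (completion P) \<A>)"
  have N: "space ?N = path_space" "sets ?N = approximable (completion P) \<A>"
    using A.space_closed A.sets_measure_of_eq by (auto simp: space_measure_of)
  have "sets (augmented_filtration P s) \<subseteq> sets ?N" for s
    unfolding N using \<C>(3) A.sigma_sets_subset[OF \<A>(4)] \<A>(5) null_parts_null_sets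
    by (intro augmented_filtration_least[of ?N, unfolded N]) auto
  then show thesis using that \<A>(1,2) A.sigma_algebra_axioms N by (simp add: UN_least)
qed

lemma complete_separable_stopping: "complete_separable_metric (stopping_space P) (stopping_dist P)"
  unfolding stopping_space_def stopping_dist_def
proof (rule complete_separable_quotient)
  let ?f = "\<lambda>\<tau> \<omega>. ext_arctan (\<tau> \<omega>)"
  have meas: "?f \<tau> \<in> borel_measurable (completion P)" if "\<tau> \<in> ext_stopping_times P" for \<tau>
    using measurable_compose[OF ext_stopping_time_completion[OF that] ext_arctan_measurable] .
  fix \<tau>1 \<tau>2 \<tau>3 assume \<tau>: "\<tau>1 \<in> ext_stopping_times P" "\<tau>2 \<in> ext_stopping_times P"
  show "0 \<le> time_dist P \<tau>1 \<tau>2" unfolding time_dist_eq by (intro comp.trunc_dist_nonneg) simp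
  show "time_dist P \<tau>1 \<tau>2 = time_dist P \<tau>2 \<tau>1" unfolding time_dist_eq by (rule comp.trunc_dist_commute)
  show "time_dist P \<tau>1 \<tau>3 \<le> time_dist P \<tau>1 \<tau>2 + time_dist P \<tau>2 \<tau>3" if "\<tau>3 \<in> ext_stopping_times P"
    unfolding time_dist_eq using meas \<tau> that by (intro comp.trunc_dist_triangle) auto
  show "time_dist P \<tau>1 \<tau>1 = 0" by (simp add: time_dist_def)
next
  show "stopping_equiv P = {(\<tau>1, \<tau>2). \<tau>1 \<in> ext_stopping_times P \<and> \<tau>2 \<in> ext_stopping_times P \<and> time_dist P \<tau>1 \<tau>2 = 0}"
  proof -
    have "measure (completion P) {\<omega> \<in> path_space. \<tau>1 \<omega> = \<tau>2 \<omega>} = 1 \<longleftrightarrow> time_dist P \<tau>1 \<tau>2 = 0"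
      if "\<tau>1 \<in> ext_stopping_times P" "\<tau>2 \<in> ext_stopping_times P" for \<tau>1 \<tau>2
    proof -
      note [measurable] = that[THEN ext_stopping_time_completion]
      have "time_dist P \<tau>1 \<tau>2 = 0 \<longleftrightarrow> (AE \<omega> in completion P. \<tau>1 \<omega> = \<tau>2 \<omega>)"
        unfolding time_dist_eq by (subst comp.trunc_dist_eq_0_iff) (simp_all add: ext_arctan_inject)
      also have "\<dots> \<longleftrightarrow> measure (completion P) {\<omega> \<in> space (completion P). \<tau>1 \<omega> = \<tau>2 \<omega>} = 1"
        by (rule comp.prob_Collect_eq_1[symmetric]) measurable
      finally show ?thesis by simp
    qed
    then show ?thesis unfolding stopping_equiv_def by auto
  qed
next
  fix \<sigma> :: "nat \<Rightarrow> (real \<Rightarrow> real^'d) \<Rightarrow> ennreal"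
  assume \<sigma>: "\<And>n. \<sigma> n \<in> ext_stopping_times P"
    and cauchy: "\<And>e. 0 < e \<Longrightarrow> \<exists>N. \<forall>m\<ge>N. \<forall>n\<ge>N. time_dist P (\<sigma> m) (\<sigma> n) < e"
  have meas: "(\<lambda>\<omega>. ext_arctan (\<tau> \<omega>)) \<in> borel_measurable (completion P)" if "\<tau> \<in> ext_stopping_times P" for \<tau>
    using measurable_compose[OF ext_stopping_time_completion[OF that] ext_arctan_measurable] .
  obtain k :: "nat \<Rightarrow> nat" where k: "strict_mono k"
    "AE \<omega> in completion P. Cauchy (\<lambda>i. ext_arctan (\<sigma> (k i) \<omega>))"
    by (rule comp.trunc_dist_Cauchy_subsequence[OF meas[OF \<sigma>] _ cauchy[unfolded time_dist_eq]]) auto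
  define \<tau> where "\<tau> \<omega> = limsup (\<lambda>i. \<sigma> (k i) \<omega>)" for \<omega>
  have \<tau>: "\<tau> \<in> ext_stopping_times P"
    unfolding \<tau>_def using \<sigma> by (rule limsup_ext_stopping_time)
  have "AE \<omega> in completion P. (\<lambda>i. ext_arctan (\<sigma> (k i) \<omega>)) \<longlonglongrightarrow> ext_arctan (\<tau> \<omega>)"
    using k(2)
  proof eventually_elim
    case (elim \<omega>)
    then obtain x where x: "(\<lambda>i. \<sigma> (k i) \<omega>) \<longlonglongrightarrow> x" "(\<lambda>i. ext_arctan (\<sigma> (k i) \<omega>)) \<longlonglongrightarrow> ext_arctan x"
      by (rule convergent_if_Cauchy_ext_arctan)
    \<comment> \<open>Almost everywhere the upper limit is a genuine limit, so it is the limit in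
      the metric as well.\<close>
    from x(1) have "\<tau> \<omega> = x" unfolding \<tau>_def by (intro lim_imp_Limsup) auto
    with x(2) show ?case by simp
  qed
  then have "(\<lambda>n. time_dist P (\<sigma> (k n)) \<tau>) \<longlonglongrightarrow> 0"
    unfolding time_dist_eq using meas \<sigma> \<tau> by (intro comp.trunc_dist_tendsto_0) auto
  then show "\<exists>\<tau>\<in>ext_stopping_times P. \<exists>k::nat\<Rightarrow>nat. strict_mono k \<and> (\<lambda>n. time_dist P (\<sigma> (k n)) \<tau>) \<longlonglongrightarrow> 0"
    using k(1) \<tau> by blast
next
  fix e :: real assume "0 < e"
  obtain \<A> where \<A>: "countable \<A>" "\<A> \<subseteq> sets (completion P)"
    "sigma_algebra path_space (approximable (completion P) \<A>)"
    "(\<Union>s. sets (augmented_filtration P s)) \<subseteq> approximable (completion P) \<A>"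
    by (rule approximation_augmented)
  interpret A: sigma_algebra path_space "approximable (completion P) \<A>" by fact
  let ?N = "sigma path_space (approximable (completion P) \<A>)"
  have N: "space ?N = path_space" "sets ?N = approximable (completion P) \<A>"
    using A.space_closed A.sets_measure_of_eq by (auto simp: space_measure_of)
  let ?f = "\<lambda>\<tau> \<omega>. ext_arctan (\<tau> \<omega>)"
  have "\<exists>\<C>. countable \<C> \<and> ?f ` ext_stopping_times P \<subseteq> \<Union>\<C> \<and>
    (\<forall>B\<in>\<C>. \<forall>f\<in>B \<inter> ?f ` ext_stopping_times P. \<forall>g\<in>B \<inter> ?f ` ext_stopping_times P. trunc_dist (completion P) 2 f g < e)"
  proof (rule comp.trunc_dist_separable[OF \<A>(1,2) _ \<open>0 < e\<close>])
    fix f and U :: "real set" assume f: "f \<in> ?f ` ext_stopping_times P" and U: "open U"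
    then obtain \<tau> where \<tau>: "\<tau> \<in> ext_stopping_times P" "f = ?f \<tau>" by blast
    have "\<tau> \<in> borel_measurable ?N"
      using \<tau>(1) \<A>(4) N by (intro borel_measurable_ext_stopping_time) auto
    then have "f \<in> borel_measurable ?N"
      unfolding \<tau>(2) by (rule measurable_compose) (rule ext_arctan_measurable)
    then have "f -` U \<inter> space ?N \<in> sets ?N" using U by (intro measurable_sets) auto
    then show "f -` U \<inter> space (completion P) \<in> approximable (completion P) \<A>" by (simp add: N)
  qed simp
  then obtain \<C> where \<C>: "countable \<C>" "?f ` ext_stopping_times P \<subseteq> \<Union>\<C>"
    "\<forall>B\<in>\<C>. \<forall>f\<in>B \<inter> ?f ` ext_stopping_times P. \<forall>g\<in>B \<inter> ?f ` ext_stopping_times P. trunc_dist (completion P) 2 f g < e"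
    by blast
  show "\<exists>\<C>. countable \<C> \<and> ext_stopping_times P \<subseteq> \<Union>\<C> \<and>
    (\<forall>B\<in>\<C>. \<forall>x\<in>B \<inter> ext_stopping_times P. \<forall>y\<in>B \<inter> ext_stopping_times P. time_dist P x y < e)"
  \<comment> \<open>The cover of the real-valued images is pulled back to stopping times; diameters
    carry over because \<open>time_dist\<close> is the truncated distance of the images.\<close>
  proof (intro exI[of _ "(\<lambda>B. ?f -` B) ` \<C>"] conjI)
    show "countable ((\<lambda>B. ?f -` B) ` \<C>)" using \<C>(1) by simp
    show "ext_stopping_times P \<subseteq> \<Union>((\<lambda>B. ?f -` B) ` \<C>)" using \<C>(2) by auto
    show "\<forall>B\<in>(\<lambda>B. ?f -` B) ` \<C>. \<forall>x\<in>B \<inter> ext_stopping_times P. \<forall>y\<in>B \<inter> ext_stopping_times P. time_dist P x y < e"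
      unfolding time_dist_eq using \<C>(3) by auto
  qed
qed

end

section \<open>Predictable processes\<close>

context wiener
begin

abbreviation time_path :: "(real \<times> (real \<Rightarrow> real^'d)) set" where
  "time_path \<equiv> {0..} \<times> path_space"

text \<open>The weight e^{-s} makes the measure finite without changing its null sets in
  \<open>time_path\<close>, and integrating against it yields the metric on controls.\<close>

definition discounted :: "(real \<times> (real \<Rightarrow> real^'d)) measure" where
  "discounted = density (restrict_space (lborel \<Otimes>\<^sub>M completion P) time_path) (\<lambda>(s, \<omega>). exp (- s))"

sublocale pair: pair_sigma_finite lborel "completion P"
  by unfold_locales

lemma sets_time_path [measurable]: "time_path \<in> sets (lborel \<Otimes>\<^sub>M completion P)"
  using sets.top[of "completion P"] by (intro pair_measureI) auto

lemma time_path_Int_space: "time_path \<inter> space (lborel \<Otimes>\<^sub>M completion P) = time_path"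
  by (auto simp: space_pair_measure)

lemma time_path_restrict: "time_path \<inter> space (lborel \<Otimes>\<^sub>M completion P) \<in> sets (lborel \<Otimes>\<^sub>M completion P)"
  unfolding time_path_Int_space by (rule sets_time_path)

lemma space_discounted [simp]: "space discounted = time_path"
  by (simp add: discounted_def space_restrict_space time_path_Int_space)

lemma sets_discounted: "A \<in> sets discounted \<longleftrightarrow> A \<subseteq> time_path \<and> A \<in> sets (lborel \<Otimes>\<^sub>M completion P)"
  by (simp only: discounted_def sets_density sets_restrict_space_iff[OF time_path_restrict])

lemma exp_measurable [measurable]:
  "(\<lambda>(s, \<omega>). exp (- s) :: real) \<in> borel_measurable (restrict_space (lborel \<Otimes>\<^sub>M completion P) time_path)"
  by (intro measurable_restrict_space1) measurable

lemma finite_measure_discounted: "finite_measure discounted"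
proof
  have "emeasure discounted (space discounted) =
      (\<integral>\<^sup>+x. ennreal (case x of (s, \<omega>) \<Rightarrow> exp (- s)) \<partial>restrict_space (lborel \<Otimes>\<^sub>M completion P) time_path)"
    unfolding discounted_def
    by (subst emeasure_density) (auto intro!: nn_integral_cong simp: indicator_def)
  also have "\<dots> = (\<integral>\<^sup>+x. ennreal (case x of (s, \<omega>) \<Rightarrow> exp (- s)) * indicator time_path x \<partial>(lborel \<Otimes>\<^sub>M completion P))"
    by (rule nn_integral_restrict_space[OF time_path_restrict])
  also have "\<dots> = (\<integral>\<^sup>+s. \<integral>\<^sup>+\<omega>. ennreal (exp (- s)) * indicator time_path (s, \<omega>) \<partial>completion P \<partial>lborel)"
    by (subst comp.nn_integral_fst[symmetric]) simp_all
  \<comment> \<open>The factor \<open>s ^ 0\<close> brings the integral into the form of Euler's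
    integral for the factorial of 0, so the total mass is 1.\<close>
  also have "\<dots> = (\<integral>\<^sup>+s. ennreal (s ^ 0 * exp (- s)) * indicator {0..} s \<partial>lborel)"
  proof (rule nn_integral_cong)
    fix s :: real
    have "(\<integral>\<^sup>+\<omega>. ennreal (exp (- s)) * indicator time_path (s, \<omega>) \<partial>completion P)
        = (\<integral>\<^sup>+\<omega>. ennreal (exp (- s)) * indicator {0..} s \<partial>completion P)"
      by (intro nn_integral_cong) (auto simp: indicator_def)
    also have "\<dots> = ennreal (exp (- s)) * indicator {0..} s"
      using comp.emeasure_space_1 by (simp only: nn_integral_const mult_1_right)
    finally show "(\<integral>\<^sup>+\<omega>. ennreal (exp (- s)) * indicator time_path (s, \<omega>) \<partial>completion P)
        = ennreal (s ^ 0 * exp (- s)) * indicator {0..} s" by simp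
  qed
  also have "\<dots> = 1" by (subst nn_intergal_power_times_exp_Ici) simp
  finally show "emeasure discounted (space discounted) \<noteq> \<infinity>" by simp
qed

sublocale disc: finite_measure discounted
  by (rule finite_measure_discounted)

lemma null_sets_discounted:
  assumes "A \<subseteq> time_path" "A \<in> null_sets (lborel \<Otimes>\<^sub>M completion P)"
  shows "A \<in> null_sets discounted"
proof -
  have "A \<in> null_sets (restrict_space (lborel \<Otimes>\<^sub>M completion P) time_path)"
    using assms null_sets_restrict_space[OF sets_time_path] by blast
  then show ?thesis
    unfolding discounted_def
    by (subst null_sets_density_iff) (auto dest: AE_not_in elim: eventually_mono)
qed

text \<open>The density is strictly positive, so discounting creates no new null sets.\<close>

lemma AE_discounted_iff:
  assumes "{x \<in> time_path. \<not> Q x} \<in> sets discounted"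
  shows "(AE x in discounted. Q x) \<longleftrightarrow> {x \<in> time_path. \<not> Q x} \<in> null_sets (lborel \<Otimes>\<^sub>M completion P)"
proof -
  have "(AE x in discounted. Q x) \<longleftrightarrow> (AE x in restrict_space (lborel \<Otimes>\<^sub>M completion P) time_path. Q x)"
    unfolding discounted_def by (subst AE_density) (auto intro!: AE_cong)
  also have "\<dots> \<longleftrightarrow> (AE x in lborel \<Otimes>\<^sub>M completion P. x \<in> time_path \<longrightarrow> Q x)"
    by (rule AE_restrict_space_iff[OF time_path_restrict])
  also have "\<dots> \<longleftrightarrow> {x \<in> space (lborel \<Otimes>\<^sub>M completion P). \<not> (x \<in> time_path \<longrightarrow> Q x)} \<in> null_sets (lborel \<Otimes>\<^sub>M completion P)"
  proof (rule AE_iff_null)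
    have "{x \<in> space (lborel \<Otimes>\<^sub>M completion P). \<not> (x \<in> time_path \<longrightarrow> Q x)} = {x \<in> time_path. \<not> Q x}"
      using time_path_Int_space by auto
    then show "{x \<in> space (lborel \<Otimes>\<^sub>M completion P). \<not> (x \<in> time_path \<longrightarrow> Q x)} \<in> sets (lborel \<Otimes>\<^sub>M completion P)"
      using assms by (simp add: sets_discounted)
  qed
  also have "{x \<in> space (lborel \<Otimes>\<^sub>M completion P). \<not> (x \<in> time_path \<longrightarrow> Q x)} = {x \<in> time_path. \<not> Q x}"
    using time_path_Int_space by auto
  finally show ?thesis .
qed

section \<open>The predictable sigma-algebra and the metric on controls\<close>

definition predictable_generators :: "(real \<times> (real \<Rightarrow> real^'d)) set set" where
  "predictable_generators =
     {{0} \<times> A | A. A \<in> sets (augmented_filtration P 0)} \<union>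
     {{s<..t} \<times> A | s t A. 0 \<le> s \<and> s < t \<and> A \<in> sets (augmented_filtration P s)}"

lemma augmented_filtration_subset_path_space: "A \<in> sets (augmented_filtration P s) \<Longrightarrow> A \<subseteq> path_space"
  using sets.sets_into_space[of A "augmented_filtration P s"] by simp

lemma predictable_generators_subset: "predictable_generators \<subseteq> Pow time_path"
  unfolding predictable_generators_def by (auto dest: augmented_filtration_subset_path_space)

lemma space_predictable [simp]: "space (predictable_sigma P) = time_path"
  unfolding predictable_sigma_def predictable_generators_def[symmetric]
  by (rule space_measure_of[OF predictable_generators_subset])

lemma sets_predictable: "sets (predictable_sigma P) = sigma_sets time_path predictable_generators"
  unfolding predictable_sigma_def predictable_generators_def[symmetric]
  by (rule sets_measure_of[OF predictable_generators_subset])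

lemma subalgebra_predictable: "subalgebra discounted (predictable_sigma P)"
proof -
  have "predictable_generators \<subseteq> sets discounted"
  proof
    fix X assume X: "X \<in> predictable_generators"
    then have "X \<subseteq> time_path" using predictable_generators_subset by auto
    moreover have "X \<in> sets (lborel \<Otimes>\<^sub>M completion P)"
      using X augmented_filtration_completion unfolding predictable_generators_def
      by (auto intro!: pair_measureI)
    ultimately show "X \<in> sets discounted" by (simp add: sets_discounted)
  qed
  then show ?thesis
    unfolding subalgebra_def sets_predictable space_discounted[symmetric]
    by (simp add: sets.sigma_sets_subset del: space_discounted) simp
qed

lemma predictable_process_measurable:
  "\<mu> \<in> predictable_processes P \<Longrightarrow> case_prod \<mu> \<in> borel_measurable (predictable_sigma P)"
  by (simp add: predictable_processes_def)

lemma predictable_process_measurable_discounted: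
  "\<mu> \<in> predictable_processes P \<Longrightarrow> case_prod \<mu> \<in> borel_measurable discounted"
  by (rule measurable_from_subalg[OF subalgebra_predictable predictable_process_measurable])

text \<open>Fubini turns the iterated integral, with time inside, into one over the product.
  Predictability supplies the joint measurability it requires.\<close>

lemma process_dist_eq:
  fixes \<mu> \<nu> :: "real \<Rightarrow> (real \<Rightarrow> real^'d) \<Rightarrow> 'u::polish_space"
  assumes \<mu>: "\<mu> \<in> predictable_processes P" and \<nu>: "\<nu> \<in> predictable_processes P"
  shows "process_dist P \<mu> \<nu> = trunc_dist discounted 1 (case_prod \<mu>) (case_prod \<nu>)"
proof -
  let ?R = "restrict_space (lborel \<Otimes>\<^sub>M completion P) time_path"
  let ?f = "\<lambda>x. min 1 (dist (case_prod \<mu> x) (case_prod \<nu> x))"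
  let ?e = "\<lambda>(s, \<omega>). exp (- s) :: real"
  let ?g = "\<lambda>s \<omega>. indicat_real time_path (s, \<omega>) *\<^sub>R (exp (- s) *\<^sub>R ?f (s, \<omega>))"
  note meas [measurable] = \<mu>[THEN predictable_process_measurable_discounted] \<nu>[THEN predictable_process_measurable_discounted]
  have int: "integrable discounted ?f"
    by (rule disc.integrable_min_dist[OF meas]) simp
  have "?f \<in> borel_measurable discounted" by measurable
  then have f: "?f \<in> borel_measurable ?R" by (simp add: discounted_def)
  have ge: "?g = (\<lambda>s \<omega>. indicat_real time_path (s, \<omega>) *\<^sub>R (?e (s, \<omega>) *\<^sub>R ?f (s, \<omega>)))" by simp
  have "integrable ?R (\<lambda>x. ?e x *\<^sub>R ?f x)"
    using int unfolding discounted_def by (subst (asm) integrable_density[OF f]) auto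
  then have "integrable (lborel \<Otimes>\<^sub>M completion P) (\<lambda>x. indicat_real time_path x *\<^sub>R (?e x *\<^sub>R ?f x))"
    unfolding integrable_restrict_space[OF time_path_restrict] .
  then have intg: "integrable (lborel \<Otimes>\<^sub>M completion P) (case_prod ?g)"
    by (rule Bochner_Integration.integrable_cong[THEN iffD1, rotated -1]) auto
  have "trunc_dist discounted 1 (case_prod \<mu>) (case_prod \<nu>) = integral\<^sup>L ?R (\<lambda>x. ?e x *\<^sub>R ?f x)"
    unfolding trunc_dist_def discounted_def by (subst integral_density[OF f]) auto
  also have "\<dots> = integral\<^sup>L (lborel \<Otimes>\<^sub>M completion P) (\<lambda>x. indicat_real time_path x *\<^sub>R (?e x *\<^sub>R ?f x))"
    by (rule integral_restrict_space[OF time_path_restrict])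
  also have "\<dots> = integral\<^sup>L (lborel \<Otimes>\<^sub>M completion P) (case_prod ?g)"
    by (rule Bochner_Integration.integral_cong) auto
  also have "\<dots> = (LINT \<omega>|completion P. LINT s|lborel. ?g s \<omega>)"
    by (rule pair.integral_snd[OF intg, symmetric])
  also have "\<dots> = process_dist P \<mu> \<nu>"
    unfolding process_dist_def set_lebesgue_integral_def
    by (intro Bochner_Integration.integral_cong) (auto simp: indicator_def)
  finally show ?thesis by simp
qed

lemma process_equiv_iff:
  fixes \<mu> \<nu> :: "real \<Rightarrow> (real \<Rightarrow> real^'d) \<Rightarrow> 'u::polish_space"
  assumes \<mu>: "\<mu> \<in> predictable_processes P" and \<nu>: "\<nu> \<in> predictable_processes P"
  shows "(\<mu>, \<nu>) \<in> process_equiv P \<longleftrightarrow> process_dist P \<mu> \<nu> = 0"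
proof -
  note meas [measurable] = \<mu>[THEN predictable_process_measurable_discounted] \<nu>[THEN predictable_process_measurable_discounted]
  have eq: "{(s, \<omega>) \<in> time_path. \<mu> s \<omega> \<noteq> \<nu> s \<omega>} = {x \<in> time_path. \<not> case_prod \<mu> x = case_prod \<nu> x}"
    by auto
  have "{x \<in> space discounted. \<not> case_prod \<mu> x = case_prod \<nu> x} \<in> sets discounted"
    by measurable
  then have sets: "{x \<in> time_path. \<not> case_prod \<mu> x = case_prod \<nu> x} \<in> sets discounted" by simp
  have "process_dist P \<mu> \<nu> = 0 \<longleftrightarrow> (AE x in discounted. case_prod \<mu> x = case_prod \<nu> x)"
    unfolding process_dist_eq[OF \<mu> \<nu>] by (rule disc.trunc_dist_eq_0_iff[OF meas]) simp
  then show ?thesis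
    unfolding process_equiv_def AE_discounted_iff[OF sets] using \<mu> \<nu> by (simp only: eq mem_Collect_eq case_prod_conv simp_thms)
qed

lemma null_strip:
  assumes "N \<in> null_sets (completion P)" "S \<in> sets lborel" "S \<subseteq> {0..}" "N \<subseteq> path_space"
  shows "S \<times> N \<in> null_sets discounted"
proof (rule null_sets_discounted)
  show "S \<times> N \<subseteq> time_path" using assms by auto
  have N: "N \<in> sets (completion P)" "emeasure (completion P) N = 0"
    using assms(1) null_setsD1 null_setsD2 by blast+
  show "S \<times> N \<in> null_sets (lborel \<Otimes>\<^sub>M completion P)"
    using comp.emeasure_pair_measure_Times[OF assms(2) N(1)] pair_measureI[OF assms(2) N(1)] N(2)
    by (intro null_setsI) simp_all
qed

text \<open>The predictable rectangles involve real times and large sigma-algebras. Half-strips with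
  rational left end over countably many path events suffice, as approximability passes successively
  to \<open>canonical_sigma_inf\<close>, to the augmented sigma-algebras, to real left ends and
  finally to rectangles.\<close>

lemma approximation_predictable:
  obtains \<A> where "countable \<A>" "\<A> \<subseteq> sets discounted"
    "sigma_algebra time_path (approximable discounted \<A>)"
    "sets (predictable_sigma P) \<subseteq> approximable discounted \<A>"
proof -
  obtain \<C> :: "(real \<Rightarrow> real^'d) set set" where \<C>: "countable \<C>" "\<C> \<subseteq> sets canonical_sigma_inf"
    "sets canonical_sigma_inf \<subseteq> sigma_sets path_space \<C>"
    by (rule canonical_sigma_inf_countably_generated)
  \<comment> \<open>A bounded strip is a difference of two half-strips. Adding
    \<open>path_space\<close> makes complements within a half-strip available.\<close>
  define \<D> where "\<D> = (\<lambda>(a, B). {a<..} \<times> B) ` ({a. a \<in> (\<rat> :: real set) \<and> 0 \<le> a} \<times> insert path_space \<C>)"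
  have "countable \<D>" unfolding \<D>_def using \<C>(1)
    by (intro countable_image countable_SIGMA) (auto intro: countable_subset[OF _ countable_rat])
  moreover have "\<D> \<subseteq> sets discounted"
  proof
    fix X assume "X \<in> \<D>"
    then obtain a :: real and B where X: "X = {a<..} \<times> B" "0 \<le> a" "B \<in> insert path_space \<C>"
      by (auto simp: \<D>_def)
    have "B \<in> sets canonical_sigma_inf"
      using X(3) \<C>(2) sets.top[of "canonical_sigma_inf :: (real \<Rightarrow> real^'d) measure"] by auto
    then have "B \<in> sets (completion P)" "B \<subseteq> path_space"
      using canonical_sigma_inf_completion sets.sets_into_space[of B canonical_sigma_inf] by auto
    then show "X \<in> sets discounted"
      unfolding sets_discounted X(1) using X(2) by (auto intro!: pair_measureI)
  qed
  ultimately obtain \<A> where \<A>: "countable \<A>" "\<A> \<subseteq> sets discounted"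
    "sigma_algebra (space discounted) (approximable discounted \<A>)"
    "\<D> \<subseteq> approximable discounted \<A>" "null_sets discounted \<subseteq> approximable discounted \<A>"
    by (rule disc.countable_approximation)
  let ?K = "approximable discounted \<A>"
  interpret K: sigma_algebra time_path ?K using \<A>(3) by simp
  have strip_inf: "{a<..} \<times> A \<in> ?K" if a: "a \<in> \<rat>" "0 \<le> a" and A: "A \<in> sigma_sets path_space \<C>" for a A
    using A
  proof (induction rule: sigma_sets.induct)
    case (Basic A)
    then show ?case using a \<A>(4) by (auto simp: \<D>_def)
  next
    case Empty
    show ?case by simp
  next
    case (Compl A)
    have "{a<..} \<times> path_space \<in> ?K" using a \<A>(4) by (auto simp: \<D>_def)
    then have "{a<..} \<times> path_space - {a<..} \<times> A \<in> ?K" using Compl by (intro K.Diff)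
    moreover have "{a<..} \<times> path_space - {a<..} \<times> A = {a<..} \<times> (path_space - A)" by auto
    ultimately show ?case by simp
  next
    case (Union A)
    then have "(\<Union>i. {a<..} \<times> A i) \<in> ?K" by (intro K.countable_UN) auto
    moreover have "(\<Union>i. {a<..} \<times> A i) = {a<..} \<times> (\<Union>i. A i)" by auto
    ultimately show ?case by simp
  qed
  have null: "S \<times> N \<in> ?K" if "N \<in> null_parts" "S \<in> sets lborel" "S \<subseteq> {0..}" for S N
    using null_strip[of N S] null_parts_null_sets null_parts_subset \<A>(5) that by blast
  have strip_rat: "{a<..} \<times> A \<in> ?K"
    if a: "a \<in> \<rat>" "0 \<le> a" and A: "A \<in> sets (augmented_filtration P s)" for a A s
  proof -
    obtain B where B: "B \<in> sets (canonical_filtration s)" "sym_diff A B \<in> null_parts"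
      using A unfolding augmented_filtration_iff by blast
    have "B \<in> sigma_sets path_space \<C>" using B(1) canonical_filtration_subset_inf \<C>(3) by blast
    then have "{a<..} \<times> B \<in> ?K" by (rule strip_inf[OF a])
    moreover have "A - B \<in> null_parts" "B - A \<in> null_parts"
      using B(2) null_parts_Un[OF B(2) B(2)] by blast+
    then have "{a<..} \<times> (A - B) \<in> ?K" "{a<..} \<times> (B - A) \<in> ?K" using a by (auto intro!: null)
    ultimately have "({a<..} \<times> B - {a<..} \<times> (B - A)) \<union> {a<..} \<times> (A - B) \<in> ?K"
      by (intro K.Un K.Diff)
    moreover have "({a<..} \<times> B - {a<..} \<times> (B - A)) \<union> {a<..} \<times> (A - B) = {a<..} \<times> A" by auto
    ultimately show ?thesis by simp
  qed
  have strip: "{r<..} \<times> A \<in> ?K" if r: "0 \<le> r" and A: "A \<in> sets (augmented_filtration P s)" for r A s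
  proof -
    \<comment> \<open>A half-strip with real left end is the countable union of those with rational
      left end at or beyond it.\<close>
    have "(\<Union>a\<in>{a\<in>\<rat>. r \<le> a}. {a<..} \<times> A) \<in> ?K"
      using r strip_rat[OF _ _ A] by (intro K.countable_UN' countable_subset[OF _ countable_rat]) auto
    moreover have "(\<Union>a\<in>{a\<in>\<rat>. r \<le> a}. {a<..} \<times> A) = {r<..} \<times> A"
    proof -
      have "\<exists>a\<in>\<rat>. r \<le> a \<and> a < x" if "r < x" for x
        using Rats_dense_in_real[OF that] by (auto intro: less_imp_le)
      then show ?thesis by fastforce
    qed
    ultimately show ?thesis by simp
  qed
  have "predictable_generators \<subseteq> ?K"
  proof
    fix X assume "X \<in> predictable_generators"
    then consider (zero) A where "X = {0} \<times> A" "A \<in> sets (augmented_filtration P 0)"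
      | (strip) s t A where "X = {s<..t} \<times> A" "0 \<le> s" "s < t" "A \<in> sets (augmented_filtration P s)"
      unfolding predictable_generators_def by blast
    then show "X \<in> ?K"
    proof cases
      case zero
      \<comment> \<open>The rectangles at time 0 sit over a single instant and are null, so they are
        approximable without any generator of their own.\<close>
      have "X \<in> null_sets discounted"
      proof (rule null_sets_discounted)
        show "X \<subseteq> time_path" using zero augmented_filtration_subset_path_space by auto
        show "X \<in> null_sets (lborel \<Otimes>\<^sub>M completion P)"
        proof -
          have A: "A \<in> sets (completion P)" using zero(2) augmented_filtration_completion by blast
          have S: "{0::real} \<in> sets lborel" by simp
          show ?thesis
            unfolding zero(1) using comp.emeasure_pair_measure_Times[OF S A] pair_measureI[OF S A]
            by (intro null_setsI) simp_all
        qed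
      qed
      then show ?thesis using \<A>(5) by blast
    next
      case strip
      have "{s<..} \<times> A - {t<..} \<times> A \<in> ?K" using strip \<open>\<And>s r A. 0 \<le> r \<Longrightarrow> A \<in> sets (augmented_filtration P s) \<Longrightarrow> {r<..} \<times> A \<in> ?K\<close>
        by (intro K.Diff) auto
      moreover have "{s<..} \<times> A - {t<..} \<times> A = X" using strip(1) by auto
      ultimately show ?thesis by simp
    qed
  qed
  then have "sets (predictable_sigma P) \<subseteq> ?K"
    unfolding sets_predictable by (rule K.sigma_sets_subset)
  then show thesis using that \<A>(1,2) K.sigma_algebra_axioms by blast
qed

lemma complete_separable_control:
  "complete_separable_metric
     (control_space P :: (real \<Rightarrow> (real \<Rightarrow> real^'d) \<Rightarrow> 'u::polish_space) set set) (control_dist P)"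
  unfolding control_space_def control_dist_def
proof (rule complete_separable_quotient)
  note meas = predictable_process_measurable_discounted
  fix \<mu> \<nu> \<rho> :: "real \<Rightarrow> (real \<Rightarrow> real^'d) \<Rightarrow> 'u"
  assume \<mu>: "\<mu> \<in> predictable_processes P"
  show "process_dist P \<mu> \<mu> = 0" by (simp add: process_dist_def)
  assume \<nu>: "\<nu> \<in> predictable_processes P"
  show "0 \<le> process_dist P \<mu> \<nu>" unfolding process_dist_eq[OF \<mu> \<nu>] by (intro disc.trunc_dist_nonneg) simp
  show "process_dist P \<mu> \<nu> = process_dist P \<nu> \<mu>"
    unfolding process_dist_eq[OF \<mu> \<nu>] process_dist_eq[OF \<nu> \<mu>] by (rule disc.trunc_dist_commute)
  assume \<rho>: "\<rho> \<in> predictable_processes P"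
  show "process_dist P \<mu> \<rho> \<le> process_dist P \<mu> \<nu> + process_dist P \<nu> \<rho>"
    unfolding process_dist_eq[OF \<mu> \<nu>] process_dist_eq[OF \<nu> \<rho>] process_dist_eq[OF \<mu> \<rho>]
    using \<mu> \<nu> \<rho> by (intro disc.trunc_dist_triangle meas) auto
next
  show "process_equiv P = {(\<mu>, \<nu> :: real \<Rightarrow> (real \<Rightarrow> real^'d) \<Rightarrow> 'u).
      \<mu> \<in> predictable_processes P \<and> \<nu> \<in> predictable_processes P \<and> process_dist P \<mu> \<nu> = 0}"
  proof -
    have "(\<mu>, \<nu>) \<in> process_equiv P \<longleftrightarrow>
        \<mu> \<in> predictable_processes P \<and> \<nu> \<in> predictable_processes P \<and> process_dist P \<mu> \<nu> = 0"
      for \<mu> \<nu> :: "real \<Rightarrow> (real \<Rightarrow> real^'d) \<Rightarrow> 'u"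
    proof -
      have "\<mu> \<in> predictable_processes P \<and> \<nu> \<in> predictable_processes P" if "(\<mu>, \<nu>) \<in> process_equiv P"
        using that by (simp add: process_equiv_def)
      then show ?thesis using process_equiv_iff[of \<mu> \<nu>] by blast
    qed
    then show ?thesis by (simp only: set_eq_iff split_paired_All mem_Collect_eq case_prod_conv simp_thms)
  qed
next
  fix \<sigma> :: "nat \<Rightarrow> real \<Rightarrow> (real \<Rightarrow> real^'d) \<Rightarrow> 'u"
  assume \<sigma>: "\<And>n. \<sigma> n \<in> predictable_processes P"
    and cauchy: "\<And>e. 0 < e \<Longrightarrow> \<exists>N. \<forall>m\<ge>N. \<forall>n\<ge>N. process_dist P (\<sigma> m) (\<sigma> n) < e"
  have "\<exists>g\<in>borel_measurable (predictable_sigma P). \<exists>k::nat\<Rightarrow>nat. strict_mono k \<and>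
    (\<lambda>n. trunc_dist discounted 1 (case_prod (\<sigma> (k n))) g) \<longlonglongrightarrow> 0"
    by (rule disc.trunc_dist_complete[OF subalgebra_predictable predictable_process_measurable[OF \<sigma>] _
          cauchy[unfolded process_dist_eq[OF \<sigma> \<sigma>]]]) auto
  then obtain g k where g: "g \<in> borel_measurable (predictable_sigma P)"
    and k: "strict_mono (k :: nat \<Rightarrow> nat)" "(\<lambda>n. trunc_dist discounted 1 (case_prod (\<sigma> (k n))) g) \<longlonglongrightarrow> 0"
    by blast
  \<comment> \<open>The limit \<open>g\<close> is measurable for \<open>predictable_sigma P\<close>
    itself and not only for its completion, so it is a predictable process.\<close>
  define \<mu> where "\<mu> = curry g"
  have \<mu>: "\<mu> \<in> predictable_processes P" using g by (simp add: predictable_processes_def \<mu>_def)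
  have "(\<lambda>n. process_dist P (\<sigma> (k n)) \<mu>) \<longlonglongrightarrow> 0"
    unfolding process_dist_eq[OF \<sigma> \<mu>] using k(2) by (simp add: \<mu>_def)
  then show "\<exists>\<mu>\<in>predictable_processes P. \<exists>k::nat\<Rightarrow>nat. strict_mono k \<and> (\<lambda>n. process_dist P (\<sigma> (k n)) \<mu>) \<longlonglongrightarrow> 0"
    using k(1) \<mu> by blast
next
  fix e :: real assume "0 < e"
  let ?S = "predictable_processes P :: (real \<Rightarrow> (real \<Rightarrow> real^'d) \<Rightarrow> 'u) set"
  obtain \<A> where \<A>: "countable \<A>" "\<A> \<subseteq> sets discounted"
    "sigma_algebra time_path (approximable discounted \<A>)"
    "sets (predictable_sigma P) \<subseteq> approximable discounted \<A>"
    by (rule approximation_predictable)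
  have "\<exists>\<C>. countable \<C> \<and> case_prod ` ?S \<subseteq> \<Union>\<C> \<and>
    (\<forall>B\<in>\<C>. \<forall>f\<in>B \<inter> case_prod ` ?S. \<forall>g\<in>B \<inter> case_prod ` ?S. trunc_dist discounted 1 f g < e)"
  proof (rule disc.trunc_dist_separable[OF \<A>(1,2) _ \<open>0 < e\<close>])
    fix f and U :: "'u set" assume f: "f \<in> case_prod ` ?S" and U: "open U"
    then have "f \<in> borel_measurable (predictable_sigma P)"
      using predictable_process_measurable by auto
    then have "f -` U \<inter> space (predictable_sigma P) \<in> sets (predictable_sigma P)"
      using U by (intro measurable_sets) auto
    then show "f -` U \<inter> space discounted \<in> approximable discounted \<A>" using \<A>(4) by auto
  qed simp
  then obtain \<C> where \<C>: "countable \<C>" "case_prod ` ?S \<subseteq> \<Union>\<C>"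
    "\<forall>B\<in>\<C>. \<forall>f\<in>B \<inter> case_prod ` ?S. \<forall>g\<in>B \<inter> case_prod ` ?S. trunc_dist discounted 1 f g < e"
    by blast
  show "\<exists>\<C>. countable \<C> \<and> ?S \<subseteq> \<Union>\<C> \<and> (\<forall>B\<in>\<C>. \<forall>x\<in>B \<inter> ?S. \<forall>y\<in>B \<inter> ?S. process_dist P x y < e)"
  proof (intro exI[of _ "(\<lambda>B. case_prod -` B) ` \<C>"] conjI)
    show "countable ((\<lambda>B. case_prod -` B :: (real \<Rightarrow> (real \<Rightarrow> real^'d) \<Rightarrow> 'u) set) ` \<C>)" using \<C>(1) by simp
    show "?S \<subseteq> \<Union>((\<lambda>B. case_prod -` B) ` \<C>)" using \<C>(2) by auto
    show "\<forall>B\<in>(\<lambda>B. case_prod -` B) ` \<C>. \<forall>x\<in>B \<inter> ?S. \<forall>y\<in>B \<inter> ?S. process_dist P x y < e"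
      using \<C>(3) by (auto simp: process_dist_eq)
  qed
qed

end

theorem lemma4p1:
  fixes P :: "(real \<Rightarrow> real^'d) measure"
  assumes "wiener_measure P"
  shows "complete_separable_metric
           (control_space P :: (real \<Rightarrow> (real \<Rightarrow> real^'d) \<Rightarrow> 'u::polish_space) set set) (control_dist P)
       \<and> complete_separable_metric (stopping_space P) (stopping_dist P)"
proof -
  have "prob_space P" using assms unfolding wiener_measure_def by (rule conjunct1)
  then interpret wiener P
    by (intro wiener.intro wiener_axioms.intro assms)
  show ?thesis using complete_separable_control complete_separable_stopping by blast
qed

end
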